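(* Let $s, t \geq 2$ be integers. Every $K^{\ast}_{s,t}$-minor-free graph $G$ is isomorphic to a subgraph of $H \boxtimes K_m$ for some graph $H$ with $\mathrm{tw}(H) \leq s$, where $m := (t-1)(\mathrm{tw}(G)+1)$.
   Context: All graphs are finite, simple and undirected. $\mathrm{tw}$ denotes treewidth. $K^{\ast}_{s,t}$ is the graph whose vertex-set is partitioned into $A \cup B$ with $|A| = s$, $|B| = t$, $A$ a clique, $B$ an independent set, and every vertex of $A$ adjacent to every vertex of $B$. The strong product $A \boxtimes B$ of graphs has vertex-set $V(A)\times V(B)$, where distinct $(v,x),(w,y)$ are adjacent if ($v=w$ and $xy\in E(B)$), or ($x=y$ and $vw\in E(A)$), or ($vw\in E(A)$ and $xy\in E(B)$). $K_m$ is the complete graph on $m$ vertices. *)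

theory Defs
  imports "Graph_Theory.Graph_Theory"
begin

text \<open>
  Finite simple undirected graphs are the library's \<^const>\<open>pair_graph\<close>: finite vertex set, symmetric
  irreflexive arc relation. The library's \<^const>\<open>tree\<close> is unsuitable for such graphs: it
  forbids every \<^const>\<open>pre_digraph.cycle\<close>, and in a symmetric digraph
  the closed walk \<open>a, b, a\<close> along a single edge is one. A cycle of a simple graph has length at least 3.
\<close>

definition undirected_tree :: "'a pair_pre_digraph \<Rightarrow> bool" where
  "undirected_tree T \<longleftrightarrow>
     pair_graph T \<and> Digraph_Component.connected (with_proj T) \<and>
     \<not> (\<exists>p. pre_digraph.cycle (with_proj T) p \<and> 3 \<le> length p)"

text \<open>Connected digraphs are nonempty by definition, so every vertex lies in some bag.\<close>

definition tree_decomposition ::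
    "'a pair_pre_digraph \<Rightarrow> 'n pair_pre_digraph \<Rightarrow> ('n \<Rightarrow> 'a set) \<Rightarrow> bool" where
  "tree_decomposition G T B \<longleftrightarrow>
     undirected_tree T \<and>
     (\<forall>x \<in> pverts T. B x \<subseteq> pverts G) \<and>
     (\<forall>(u, v) \<in> parcs G. \<exists>x \<in> pverts T. u \<in> B x \<and> v \<in> B x) \<and>
     (\<forall>v \<in> pverts G. Digraph_Component.connected (with_proj T \<restriction> {x \<in> pverts T. v \<in> B x}))"

definition decomposition_width :: "'n pair_pre_digraph \<Rightarrow> ('n \<Rightarrow> 'a set) \<Rightarrow> nat" where
  "decomposition_width T B = Max ((\<lambda>x. card (B x)) ` pverts T) - 1"

text \<open>
  Every finite tree is isomorphic to one with nodes in \<^typ>\<open>nat\<close>. By truncated subtraction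
  the graph without vertices gets treewidth 0.
\<close>

definition treewidth :: "'a pair_pre_digraph \<Rightarrow> nat" where
  "treewidth G = (LEAST k. \<exists>(T :: nat pair_pre_digraph) B.
     tree_decomposition G T B \<and> decomposition_width T B = k)"

definition isomorphic_to_subgraph :: "'a pair_pre_digraph \<Rightarrow> 'b pair_pre_digraph \<Rightarrow> bool" where
  "isomorphic_to_subgraph G P \<longleftrightarrow>
     (\<exists>S. pair_graph S \<and> subgraph (with_proj S) (with_proj P) \<and>
          digraph_iso (with_proj G) (with_proj S))"

text \<open>\<open>v\<close> is merged into \<open>u\<close>; the resulting loops disappear, and so do parallel edges.\<close>

definition contract_edge :: "'a pair_pre_digraph \<Rightarrow> 'a \<Rightarrow> 'a \<Rightarrow> 'a pair_pre_digraph" where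
  "contract_edge G u v =
     \<lparr> pverts = pverts G - {v},
       parcs = map_prod (id(v := u)) (id(v := u)) ` parcs G - Id \<rparr>"

inductive contracts_to :: "'a pair_pre_digraph \<Rightarrow> 'a pair_pre_digraph \<Rightarrow> bool" where
  refl: "contracts_to G G"
| step: "contracts_to G G' \<Longrightarrow> (u, v) \<in> parcs G' \<Longrightarrow> contracts_to G (contract_edge G' u v)"

definition minor :: "'b pair_pre_digraph \<Rightarrow> 'a pair_pre_digraph \<Rightarrow> bool" where
  "minor X G \<longleftrightarrow>
     (\<exists>S M. pair_graph S \<and> subgraph (with_proj S) (with_proj G) \<and> contracts_to S M \<and>
            digraph_iso (with_proj X) (with_proj M))"

definition K_star :: "nat \<Rightarrow> nat \<Rightarrow> (nat + nat) pair_pre_digraph" where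
  "K_star s t =
     (let A = Inl ` {..<s}; B = Inr ` {..<t}
      in \<lparr> pverts = A \<union> B, parcs = (A \<times> A - Id) \<union> A \<times> B \<union> B \<times> A \<rparr>)"

definition complete_graph :: "nat \<Rightarrow> nat pair_pre_digraph" where
  "complete_graph m = \<lparr> pverts = {..<m}, parcs = {..<m} \<times> {..<m} - Id \<rparr>"

definition strong_product ::
    "'a pair_pre_digraph \<Rightarrow> 'b pair_pre_digraph \<Rightarrow> ('a \<times> 'b) pair_pre_digraph"
    (infixr \<open>\<boxtimes>\<close> 70) where
  "G \<boxtimes> H =
     \<lparr> pverts = pverts G \<times> pverts H,
       parcs = {((v, x), (w, y)).
         (v, x) \<in> pverts G \<times> pverts H \<and> (w, y) \<in> pverts G \<times> pverts H \<and>
         (v = w \<and> (x, y) \<in> parcs H \<or>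
          x = y \<and> (v, w) \<in> parcs G \<or>
          (v, w) \<in> parcs G \<and> (x, y) \<in> parcs H)} \<rparr>"

lemma pair_graph_iff:
  "pair_graph G \<longleftrightarrow>
     finite (pverts G) \<and> parcs G \<subseteq> pverts G \<times> pverts G \<and> sym (parcs G) \<and> irrefl (parcs G)"
proof
  assume "pair_graph G"
  then interpret pair_graph G .
  have "irrefl (parcs G)"
    using no_loops' by (auto simp: irrefl_def)
  then show "finite (pverts G) \<and> parcs G \<subseteq> pverts G \<times> pverts G \<and> sym (parcs G) \<and> irrefl (parcs G)"
    using pair_finite_verts pair_sym_arcs wellformed' by (auto simp: symmetric_def)
next
  assume *: "finite (pverts G) \<and> parcs G \<subseteq> pverts G \<times> pverts G \<and> sym (parcs G) \<and> irrefl (parcs G)"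
  then have "finite (parcs G)"
    by (meson finite_SigmaI finite_subset)
  with * show "pair_graph G"
    by unfold_locales (auto simp: symmetric_def irrefl_def)
qed

lemma pair_graph_contract_edge:
  assumes "pair_graph G" "(u, v) \<in> parcs G"
  shows "pair_graph (contract_edge G u v)"
proof -
  have G: "finite (pverts G)" "parcs G \<subseteq> pverts G \<times> pverts G" "sym (parcs G)" "irrefl (parcs G)"
    using assms(1) by (auto simp: pair_graph_iff)
  have "u \<noteq> v" "u \<in> pverts G"
    using G assms(2) by (auto simp: irrefl_def)
  moreover have "sym (map_prod f f ` parcs G - Id)" for f :: "'a \<Rightarrow> 'a"
    using G(3) by (force simp: sym_def)
  ultimately show ?thesis
    using G by (auto simp: pair_graph_iff contract_edge_def irrefl_def split: if_splits)
qed

lemma pair_graph_contracts_to: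
  assumes "contracts_to G M" "pair_graph G"
  shows "pair_graph M"
  using assms by (induction rule: contracts_to.induct) (simp_all add: pair_graph_contract_edge)

lemma pair_graph_K_star: "pair_graph (K_star s t)"
proof -
  define A :: "(nat + nat) set" where "A = Inl ` {..<s}"
  define B :: "(nat + nat) set" where "B = Inr ` {..<t}"
  have "finite A" "finite B" "A \<inter> B = {}"
    by (auto simp: A_def B_def)
  then show ?thesis
    unfolding K_star_def Let_def A_def[symmetric] B_def[symmetric] pair_graph_iff
    by (auto intro!: symI irreflI)
qed

lemma complete_digraph_complete_graph: "K\<^bsub>m\<^esub> (with_proj (complete_graph m))"
  by (auto simp: complete_digraph_pair_def complete_graph_def)

lemma pair_graph_complete_graph: "pair_graph (complete_graph m)"
  using complete_digraph_complete_graph by (rule pair_graphI_complete)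

lemma pair_graph_strong_product:
  assumes "pair_graph G" "pair_graph H"
  shows "pair_graph (G \<boxtimes> H)"
proof -
  have "sym (parcs (G \<boxtimes> H))"
    using assms by (intro symI) (auto simp: pair_graph_iff strong_product_def dest: symD)
  moreover have "irrefl (parcs (G \<boxtimes> H))"
    using assms by (intro irreflI) (auto simp: pair_graph_iff strong_product_def dest: irreflD)
  ultimately show ?thesis
    using assms unfolding pair_graph_iff by (auto simp: strong_product_def)
qed

lemma undirected_tree_single: "undirected_tree \<lparr> pverts = {x}, parcs = {} \<rparr>"
proof -
  have "pair_graph \<lparr> pverts = {x}, parcs = {} \<rparr>"
    by (auto simp: pair_graph_iff sym_def irrefl_def)
  moreover have "\<not> pre_digraph.cycle (with_proj \<lparr> pverts = {x}, parcs = {} \<rparr>) p" for p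
    by (auto simp: pre_digraph.cycle_def pre_digraph.awalk_def)
  ultimately show ?thesis
    by (auto simp: undirected_tree_def Digraph_Component.connected_def strongly_connected_def
        mk_symmetric_def reachable_def)
qed

lemma tree_decomposition_single:
  assumes "pair_graph G"
  shows "tree_decomposition G \<lparr> pverts = {x}, parcs = {} \<rparr> (\<lambda>_. pverts G)"
proof -
  have "parcs G \<subseteq> pverts G \<times> pverts G"
    using assms by (simp add: pair_graph_iff)
  then have "\<forall>(u, v) \<in> parcs G. u \<in> pverts G \<and> v \<in> pverts G"
    by auto
  moreover have "Digraph_Component.connected (with_proj \<lparr> pverts = {x}, parcs = {} \<rparr> \<restriction> {x})"
    by (simp add: Digraph_Component.connected_def strongly_connected_def mk_symmetric_def
        reachable_def)
  ultimately show ?thesis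
    using undirected_tree_single[of x] by (simp add: tree_decomposition_def)
qed

lemma treewidth_attained:
  assumes "pair_graph G"
  shows "\<exists>(T :: nat pair_pre_digraph) B.
    tree_decomposition G T B \<and> decomposition_width T B = treewidth G"
proof -
  let ?P = "\<lambda>k. \<exists>(T :: nat pair_pre_digraph) B.
    tree_decomposition G T B \<and> decomposition_width T B = k"
  let ?T = "\<lparr> pverts = {0}, parcs = {} \<rparr> :: nat pair_pre_digraph"
  have "?P (decomposition_width ?T (\<lambda>_. pverts G))"
    by (rule exI[of _ ?T], rule exI[of _ "\<lambda>_. pverts G"])
      (simp add: tree_decomposition_single[OF assms])
  then show ?thesis
    unfolding treewidth_def by (rule LeastI)
qed

end

theory Submission
  imports Defs
begin

text \<open>
  Partition \<open>V(G)\<close> into parts greedily. For every component \<open>C\<close> of the graph induced by the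
  unpartitioned vertices, maintain at most \<open>s\<close> parts that contain all neighbours of \<open>C\<close>, together
  with pairwise disjoint, pairwise touching connected sets \<open>U i\<close> avoiding \<open>C\<close>, where \<open>U i\<close> contains
  the neighbours of \<open>C\<close> in the \<open>i\<close>-th part. Call a connected subset of \<open>C\<close> full if it touches all \<open>U i\<close>.

  If there are \<open>s\<close> parts around \<open>C\<close>, then \<open>t\<close> disjoint full sets would give a \<open>K\<^sup>*\<close> minor, so the
  Erdos-Posa property of connected sets in a tree decomposition yields at most \<open>(t - 1)(tw + 1)\<close>
  vertices meeting all full sets. If there are fewer than \<open>s\<close> parts, a lowest bag below which
  there is a full set \<open>Y\<close> is used instead; \<open>Y\<close> then serves as an additional set \<open>U i\<close> for
  the components above the bag. In both cases a smallest choice \<open>X\<close> of the new part has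
  the property that for a component \<open>C'\<close> of \<open>C - X\<close> that misses \<open>U j\<close>, all neighbours of \<open>C'\<close> in \<open>X\<close> are
  connected to \<open>U j\<close> outside of \<open>C'\<close>, so that \<open>U j\<close> can be enlarged to contain them and \<open>X\<close> replaces
  the \<open>j\<close>-th part.
\<close>

section \<open>Connected sets and components\<close>

text \<open>Connectivity in a bare relation serves graphs and decomposition trees alike. The empty
  set is excluded, so that branch sets of minors are nonempty.\<close>

definition conn :: "'a rel \<Rightarrow> 'a set \<Rightarrow> bool" where
  "conn E S \<longleftrightarrow> S \<noteq> {} \<and> (\<forall>x\<in>S. \<forall>y\<in>S. (x, y) \<in> (E \<inter> S \<times> S)\<^sup>*)"

definition touches :: "'a rel \<Rightarrow> 'a set \<Rightarrow> 'a set \<Rightarrow> bool" where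
  "touches E A B \<longleftrightarrow> (\<exists>a\<in>A. \<exists>b\<in>B. (a, b) \<in> E)"

definition component :: "'a rel \<Rightarrow> 'a set \<Rightarrow> 'a set \<Rightarrow> bool" where
  "component E W C \<longleftrightarrow> C \<subseteq> W \<and> conn E C \<and> (\<forall>y\<in>C. \<forall>z\<in>W. (y, z) \<in> E \<longrightarrow> z \<in> C)"

lemma touches_sym: "sym E \<Longrightarrow> touches E A B \<Longrightarrow> touches E B A"
  by (auto simp: touches_def dest: symD)

lemma conn_nonempty: "conn E S \<Longrightarrow> S \<noteq> {}"
  by (simp add: conn_def)

text \<open>A walk inside \<open>D\<close> that starts at \<open>x\<close> cannot leave
  \<open>C\<close>. Most later arguments that confine a connected set use this form.\<close>

lemma conn_closed_subset:
  assumes "conn E D" "x \<in> D" "x \<in> C"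
    and closed: "\<And>y z. y \<in> C \<Longrightarrow> y \<in> D \<Longrightarrow> z \<in> D \<Longrightarrow> (y, z) \<in> E \<Longrightarrow> z \<in> C"
  shows "D \<subseteq> C"
proof
  fix y assume "y \<in> D"
  then have "(x, y) \<in> (E \<inter> D \<times> D)\<^sup>*"
    using assms by (auto simp: conn_def)
  then show "y \<in> C"
    by (induction rule: rtrancl_induct) (use assms in auto)
qed

lemma connI_center:
  assumes "sym E" "c \<in> S" and "\<And>x. x \<in> S \<Longrightarrow> (c, x) \<in> (E \<inter> S \<times> S)\<^sup>*"
  shows "conn E S"
proof -
  have "sym (E \<inter> S \<times> S)"
    using assms(1) by (auto simp: sym_def)
  then have "sym ((E \<inter> S \<times> S)\<^sup>*)"
    by (rule sym_rtrancl)
  then show ?thesis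
    using assms(2,3) unfolding conn_def by (meson empty_iff rtrancl_trans symD)
qed

lemma rtrancl_Int_Times_mono:
  "(x, y) \<in> (E \<inter> A \<times> A)\<^sup>* \<Longrightarrow> A \<subseteq> B \<Longrightarrow> (x, y) \<in> (E \<inter> B \<times> B)\<^sup>*"
  by (rule set_rev_mp[OF _ rtrancl_mono]) auto

text \<open>Every point is reached from a fixed point of \<open>A\<close>, first inside
  \<open>A\<close> and then inside its own \<open>Z\<close>. The version for families serves to
  enlarge a set by all components that it touches.\<close>

lemma conn_Un_UNION:
  assumes "sym E" "conn E A" "\<And>Z. Z \<in> \<Z> \<Longrightarrow> conn E Z \<and> (touches E A Z \<or> A \<inter> Z \<noteq> {})"
  shows "conn E (A \<union> \<Union>\<Z>)" (is "conn E ?S")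
proof -
  obtain c where c: "c \<in> A"
    using assms(2) by (auto simp: conn_def)
  show ?thesis
  proof (rule connI_center[OF assms(1)])
    show "c \<in> ?S"
      using c by simp
    fix x assume x: "x \<in> ?S"
    have A: "(c, a) \<in> (E \<inter> ?S \<times> ?S)\<^sup>*" if "a \<in> A" for a
      using assms(2) c that by - (rule rtrancl_Int_Times_mono[of _ _ E A ?S], auto simp: conn_def)
    show "(c, x) \<in> (E \<inter> ?S \<times> ?S)\<^sup>*"
    proof (cases "x \<in> A")
      case True
      then show ?thesis by (rule A)
    next
      case False
      then obtain Z where Z: "Z \<in> \<Z>" "x \<in> Z"
        using x by auto
      have Zx: "(z, x) \<in> (E \<inter> ?S \<times> ?S)\<^sup>*" if "z \<in> Z" for z
        using assms(3)[OF Z(1)] that Z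
        by - (rule rtrancl_Int_Times_mono[of _ _ E Z ?S], auto simp: conn_def)
      from assms(3)[OF Z(1)] consider a z where "a \<in> A" "z \<in> Z" "(a, z) \<in> E" | z where "z \<in> A" "z \<in> Z"
        by (auto simp: touches_def)
      then show ?thesis
      proof cases
        case 1
        then have "(a, z) \<in> E \<inter> ?S \<times> ?S"
          using Z by auto
        with A[OF 1(1)] Zx[OF 1(2)] show ?thesis
          by (meson rtrancl.rtrancl_into_rtrancl rtrancl_trans)
      next
        case 2
        then show ?thesis
          using A Zx by (meson rtrancl_trans)
      qed
    qed
  qed
qed

lemma conn_Un:
  assumes "sym E" "conn E A" "conn E B" "touches E A B \<or> A \<inter> B \<noteq> {}"
  shows "conn E (A \<union> B)"
  using conn_Un_UNION[of E A "{B}"] assms by auto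

lemma component_exists:
  assumes "sym E" "x \<in> W"
  shows "\<exists>C. component E W C \<and> x \<in> C"
proof -
  define C where "C = (E \<inter> W \<times> W)\<^sup>* `` {x}"
  have CW: "C \<subseteq> W"
  proof
    fix y assume "y \<in> C"
    then have "(x, y) \<in> (E \<inter> W \<times> W)\<^sup>*" by (simp add: C_def)
    then show "y \<in> W"
      by (cases rule: rtrancl.cases) (use assms in auto)
  qed
  have "(x, y) \<in> (E \<inter> C \<times> C)\<^sup>*" if "y \<in> C" for y
  proof -
    have "(x, y) \<in> (E \<inter> W \<times> W)\<^sup>*" using that by (simp add: C_def)
    then show ?thesis
    proof (induction rule: rtrancl_induct)
      case (step y z)
      then have "y \<in> C" "z \<in> C"
        by (auto simp: C_def intro: rtrancl_into_rtrancl)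
      with step show ?case
        by (meson IntD1 IntI SigmaI rtrancl.rtrancl_into_rtrancl)
    qed simp
  qed
  then have "conn E C"
    by (intro connI_center[OF assms(1), of x]) (auto simp: C_def)
  moreover have "z \<in> C" if "y \<in> C" "z \<in> W" "(y, z) \<in> E" for y z
    using that CW by (auto simp: C_def intro: rtrancl_into_rtrancl)
  ultimately have "component E W C"
    using CW by (auto simp: component_def)
  then show ?thesis
    by (auto simp: C_def)
qed

lemma component_absorb:
  assumes "component E W C" "conn E D" "D \<subseteq> W" "D \<inter> C \<noteq> {}"
  shows "D \<subseteq> C"
proof -
  obtain x where "x \<in> D" "x \<in> C" using assms(4) by auto
  then show ?thesis
    using assms by (intro conn_closed_subset[OF assms(2)]) (auto simp: component_def)
qed

lemma component_eq:
  assumes "component E W C" "component E W D" "C \<inter> D \<noteq> {}"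
  shows "C = D"
  using component_absorb[OF assms(1), of D] component_absorb[OF assms(2), of C] assms
  by (auto simp: component_def)

section \<open>Transfer to the connectivity of the graph library, and trees\<close>

lemma connected_induce_iff_conn:
  assumes "sym (parcs T)"
  shows "Digraph_Component.connected (with_proj T \<restriction> S) \<longleftrightarrow> conn (parcs T) S"
proof -
  let ?R = "parcs T \<inter> S \<times> S"
  have eq: "parcs (mk_symmetric (with_proj T \<restriction> S)) = ?R"
    using assms by (auto simp: parcs_mk_symmetric dest: symD)
  have "(x, y) \<in> rtrancl_on S ?R \<longleftrightarrow> (x, y) \<in> ?R\<^sup>*" if "x \<in> S" for x y
  proof
    assume "(x, y) \<in> ?R\<^sup>*"
    then show "(x, y) \<in> rtrancl_on S ?R"
      by (induction rule: rtrancl_induct) (use that in \<open>auto intro: rtrancl_on_into_rtrancl_on\<close>)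
  qed (rule rtrancl_on_rtranclI)
  then show ?thesis
    by (auto simp: Digraph_Component.connected_def strongly_connected_def reachable_def conn_def eq)
qed

lemma connected_iff_conn:
  assumes "pair_graph T"
  shows "Digraph_Component.connected (with_proj T) \<longleftrightarrow> conn (parcs T) (pverts T)"
proof -
  have "with_proj T \<restriction> pverts T = with_proj T"
    using assms by (auto simp: induce_subgraph_def with_proj_def pair_graph_iff)
  then show ?thesis
    using connected_induce_iff_conn[of T "pverts T"] assms by (simp add: pair_graph_iff)
qed

text \<open>A path from \<open>y\<close> to \<open>z\<close> inside \<open>S\<close> would close
  through \<open>x\<close> to a cycle. Hence a subtree that remains after deleting \<open>x\<close>
  hangs on \<open>x\<close> by at most one edge.\<close>

lemma tree_unique_attachment:
  assumes T: "undirected_tree T" and S: "conn (parcs T) S" "S \<subseteq> pverts T" "x \<notin> S"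
    and y: "y \<in> S" "(x, y) \<in> parcs T" and z: "z \<in> S" "(x, z) \<in> parcs T"
  shows "y = z"
proof (rule ccontr)
  assume "y \<noteq> z"
  from T have "pair_graph T" by (simp add: undirected_tree_def)
  then interpret T: pair_graph T .
  \<comment> \<open>Taking the path in the graph induced on \<open>S\<close> makes it avoid
    \<open>x\<close>.\<close>
  define R where "R = \<lparr>pverts = S, parcs = parcs T \<inter> S \<times> S\<rparr>"
  interpret R: pair_wf_digraph R
    by unfold_locales (auto simp: R_def)
  have "(y, z) \<in> (parcs R)\<^sup>*"
    using S y z by (auto simp: conn_def R_def)
  then have "reachable (with_proj R) y z"
    using y(1) z(1) by (simp add: R.reachable_conv) (auto simp: R_def)
  then obtain p where p: "R.apath y p z"
    using R.reachable_apath by auto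
  then have pR: "set p \<subseteq> parcs R" "pcas y p z" "distinct (pawalk_verts y p)"
    by (auto simp: R.apath_def R.awalk_def)
  have pS: "set (pawalk_verts y p) \<subseteq> S"
    using p R.awalk_conv[of y p z] by (auto simp: R.apath_def) (auto simp: R_def)
  have pne: "p \<noteq> []"
    using pR \<open>y \<noteq> z\<close> by auto
  have zx: "(z, x) \<in> parcs T"
    using z T.pair_sym_arcs by (auto simp: symmetric_def dest: symD)
  let ?c = "(x, y) # p @ [(z, x)]"
  have app: "pcas a (q @ r) c \<longleftrightarrow> (\<exists>b. pcas a q b \<and> pcas b r c)" for a q r and c :: 'a
    by (induction q arbitrary: a) auto
  have verts: "pawalk_verts a (q @ [(b, c)]) = pawalk_verts a q @ [c]" if "pcas a q b" for a q b and c :: 'a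
    using that by (induction q arbitrary: a) auto
  have "T.awalk x ?c x"
    using pR y zx T.wellformed' by (auto simp: T.awalk_def app R_def)
  moreover have "distinct (tl (pawalk_verts x ?c))"
    using pR pS S(3) by (auto simp: verts)
  ultimately have "T.cycle ?c"
    unfolding T.cycle_def by auto
  moreover have "3 \<le> length ?c"
    using pne by (cases p) auto
  ultimately show False
    using T by (auto simp: undirected_tree_def)
qed

section \<open>Separations from tree decompositions\<close>

text \<open>This is all that later arguments retain of a tree decomposition with bags of size at
  most \<open>q\<close>. For a family \<open>F\<close>, \<open>W\<close> collects the bags of a
  smallest subtree that still holds a member, and \<open>B\<close> is the bag at which this subtree
  is attached.\<close>

definition separable :: "'a rel \<Rightarrow> 'a set \<Rightarrow> nat \<Rightarrow> bool" where
  "separable E V q \<longleftrightarrow> (\<forall>F. F \<noteq> {} \<longrightarrow> (\<forall>D\<in>F. D \<subseteq> V \<and> conn E D) \<longrightarrow>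
     (\<exists>W B. B \<subseteq> W \<and> W \<subseteq> V \<and> card B \<le> q \<and> (\<exists>D\<in>F. D \<subseteq> W) \<and> (\<forall>D\<in>F. \<not> D \<subseteq> W - B) \<and>
       (\<forall>a\<in>W - B. \<forall>b. (a, b) \<in> E \<longrightarrow> b \<in> W)))"

text \<open>Choose a smallest good branch \<open>S\<close>, attached at \<open>x\<close>, and
  separate with \<open>B x\<close>. A member of \<open>F\<close> inside \<open>bags S - B x\<close>
  would live in the bags of one component of \<open>S - {x}\<close>, which would be a smaller good
  branch.\<close>

lemma separable_tree_decomposition:
  assumes G: "pair_graph G" and TB: "tree_decomposition G T B"
    and q: "\<And>x. x \<in> pverts T \<Longrightarrow> card (B x) \<le> q"
  shows "separable (parcs G) (pverts G) q"
  unfolding separable_def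
proof (intro allI impI)
  fix F :: "'a set set"
  assume Fne: "F \<noteq> {}" and F: "\<forall>D\<in>F. D \<subseteq> pverts G \<and> conn (parcs G) D"
  have T: "undirected_tree T" and BV: "\<And>x. x \<in> pverts T \<Longrightarrow> B x \<subseteq> pverts G"
    and edge: "\<And>u v. (u, v) \<in> parcs G \<Longrightarrow> \<exists>x\<in>pverts T. u \<in> B x \<and> v \<in> B x"
    using TB by (auto simp: tree_decomposition_def)
  have Tg: "pair_graph T"
    using T by (simp add: undirected_tree_def)
  then have finT: "finite (pverts T)" and symT: "sym (parcs T)"
    and wfT: "parcs T \<subseteq> pverts T \<times> pverts T"
    by (auto simp: pair_graph_iff)
  define tr where "tr v = {x \<in> pverts T. v \<in> B x}" for v
  have tr: "conn (parcs T) (tr v)" if "v \<in> pverts G" for v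
    using TB that connected_induce_iff_conn[OF symT] by (simp add: tree_decomposition_def tr_def)
  define bags where "bags S = (\<Union>x\<in>S. B x)" for S
  \<comment> \<open>Since arcs leave \<open>S\<close> only at \<open>x\<close>, a branch stands for
    the subtree below a node, without orienting the tree.\<close>
  define branch where "branch S x \<longleftrightarrow> S \<subseteq> pverts T \<and> conn (parcs T) S \<and> x \<in> S \<and>
    (\<forall>y\<in>S. \<forall>z. (y, z) \<in> parcs T \<longrightarrow> z \<notin> S \<longrightarrow> y = x)" for S x
  define good where "good S \<longleftrightarrow> (\<exists>x. branch S x) \<and> (\<exists>D\<in>F. D \<subseteq> bags S)" for S
  have Tconn: "conn (parcs T) (pverts T)"
    using T Tg connected_iff_conn by (auto simp: undirected_tree_def)
  then obtain r where "r \<in> pverts T"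
    by (auto simp: conn_def)
  then have "branch (pverts T) r"
    using Tconn wfT by (auto simp: branch_def)
  moreover have "v \<in> bags (pverts T)" if "v \<in> pverts G" for v
    using conn_nonempty[OF tr[OF that]] by (auto simp: tr_def bags_def)
  ultimately have "good (pverts T)"
    using Fne F unfolding good_def by blast
  from ex_has_least_nat[of good, OF this, of card]
  obtain S where S: "good S" and min: "\<And>S'. good S' \<Longrightarrow> card S \<le> card S'"
    by auto
  then obtain x where x: "branch S x"
    by (auto simp: good_def)
  have xS: "x \<in> S" "S \<subseteq> pverts T"
    using x by (auto simp: branch_def)
  \<comment> \<open>The trace of \<open>v\<close> is connected, meets \<open>S\<close> and misses
    \<open>x\<close>, the only exit from \<open>S\<close>.\<close>
  have inside: "tr v \<subseteq> S - {x}" if v: "v \<in> pverts G" "v \<in> bags S" "v \<notin> B x" for v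
  proof -
    obtain y where y: "y \<in> S" "v \<in> B y"
      using v by (auto simp: bags_def)
    have "x \<notin> tr v"
      using v by (simp add: tr_def)
    moreover have "tr v \<subseteq> S"
      using tr[OF v(1)]
    proof (rule conn_closed_subset)
      show "y \<in> tr v" "y \<in> S"
        using y xS by (auto simp: tr_def)
      show "z \<in> S" if "y \<in> S" "y \<in> tr v" "(y, z) \<in> parcs T" for y z
        using that x \<open>x \<notin> tr v\<close> by (auto simp: branch_def)
    qed
    ultimately show ?thesis
      by auto
  qed
  show "\<exists>W B. B \<subseteq> W \<and> W \<subseteq> pverts G \<and> card B \<le> q \<and> (\<exists>D\<in>F. D \<subseteq> W) \<and> (\<forall>D\<in>F. \<not> D \<subseteq> W - B) \<and>
       (\<forall>a\<in>W - B. \<forall>b. (a, b) \<in> parcs G \<longrightarrow> b \<in> W)"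
  proof (intro exI conjI ballI allI impI)
    show "B x \<subseteq> bags S" "bags S \<subseteq> pverts G" "card (B x) \<le> q"
      using xS BV q by (auto simp: bags_def)
    show "\<exists>D\<in>F. D \<subseteq> bags S"
      using S by (simp add: good_def)
  next
    fix a b assume a: "a \<in> bags S - B x" and ab: "(a, b) \<in> parcs G"
    obtain z where z: "z \<in> pverts T" "a \<in> B z" "b \<in> B z"
      using edge[OF ab] by auto
    moreover have "a \<in> pverts G"
      using ab G by (auto simp: pair_graph_iff)
    ultimately have "z \<in> S"
      using inside[of a] a by (auto simp: tr_def)
    then show "b \<in> bags S"
      using z by (auto simp: bags_def)
  next
    fix D assume D: "D \<in> F"
    show "\<not> D \<subseteq> bags S - B x"
    proof
      assume sub: "D \<subseteq> bags S - B x"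
      have Dc: "conn (parcs G) D" and DV: "D \<subseteq> pverts G"
        using F D by auto
      obtain v where v: "v \<in> D"
        using conn_nonempty[OF Dc] by auto
      obtain y where y: "y \<in> tr v"
        using conn_nonempty[OF tr] v DV by blast
      have trD: "tr u \<subseteq> S - {x}" if "u \<in> D" for u
        using inside that sub DV by blast
      have "y \<in> S - {x}"
        using trD v y by auto
      from component_exists[OF symT this]
      obtain Z where Z: "component (parcs T) (S - {x}) Z" and yZ: "y \<in> Z"
        by auto
      have absorb: "tr u \<subseteq> Z" if "u \<in> D" "tr u \<inter> Z \<noteq> {}" for u
        using component_absorb[OF Z tr trD] that DV by blast
      \<comment> \<open>Adjacent vertices share a bag, so their traces meet and lie in the same
        component. As \<open>D\<close> is connected, one component \<open>Z\<close> holds all of its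
        traces.\<close>
      have "D \<subseteq> {u. tr u \<subseteq> Z}"
        using Dc v
      proof (rule conn_closed_subset)
        show "v \<in> {u. tr u \<subseteq> Z}"
          using absorb[OF v] y yZ by auto
        fix u w assume u: "u \<in> {u. tr u \<subseteq> Z}" and w: "w \<in> D" "(u, w) \<in> parcs G"
        then have "tr u \<inter> tr w \<noteq> {}"
          using edge[OF w(2)] by (auto simp: tr_def)
        then show "w \<in> {u. tr u \<subseteq> Z}"
          using absorb[OF w(1)] u by auto
      qed
      then have "D \<subseteq> bags Z"
        using conn_nonempty[OF tr] DV by (fastforce simp: bags_def tr_def)
      \<comment> \<open>Arcs out of \<open>Z\<close> end in \<open>x\<close>, and by
        \<open>tree_unique_attachment\<close> they all start at one node. If there is no such arc,
        any node of \<open>Z\<close> will do.\<close>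
      moreover have "\<exists>x'. branch Z x'"
      proof -
        have Zp: "Z \<subseteq> pverts T" "conn (parcs T) Z" "x \<notin> Z" "Z \<subseteq> S"
          using Z xS by (auto simp: component_def)
        have exit: "z = x" if "y \<in> Z" "(y, z) \<in> parcs T" "z \<notin> Z" for y z
          using that Z x unfolding component_def branch_def by blast
        have uniq: "y = y'" if "y \<in> Z" "(y, x) \<in> parcs T" "y' \<in> Z" "(y', x) \<in> parcs T" for y y'
          using that tree_unique_attachment[OF T Zp(2,1,3)] symT by (meson symD)
        show ?thesis
        proof (cases "\<exists>x'\<in>Z. (x', x) \<in> parcs T")
          case True
          then obtain x' where "x' \<in> Z" "(x', x) \<in> parcs T" by auto
          then have "branch Z x'"
            using Zp exit uniq unfolding branch_def by blast
          then show ?thesis ..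
        next
          case False
          then have "branch Z y"
            using Zp exit yZ unfolding branch_def by blast
          then show ?thesis ..
        qed
      qed
      ultimately have "good Z"
        using D by (auto simp: good_def)
      moreover have "card Z < card S"
        using Z xS finT by (intro psubset_card_mono) (auto simp: component_def intro: finite_subset)
      ultimately show False
        using min[of Z] by simp
    qed
  qed
qed

text \<open>An Erdos-Posa argument by induction: a member \<open>D\<close> inside \<open>W\<close>
  extends a packing, and \<open>B\<close> extends a hitting set, of the members that avoid
  \<open>B\<close>. The indices \<open>i \<le> n\<close> count \<open>n + 1\<close> members.\<close>

lemma packing_or_hitting:
  assumes sep: "separable E V q" and "\<forall>D\<in>F. D \<subseteq> V \<and> conn E D"
  shows "(\<exists>d. (\<forall>i\<le>n. d i \<in> F) \<and> (\<forall>i\<le>n. \<forall>j\<le>n. i \<noteq> j \<longrightarrow> d i \<inter> d j = {})) \<or>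
    (\<exists>X\<subseteq>V. card X \<le> n * q \<and> (\<forall>D\<in>F. D \<inter> X \<noteq> {}))"
  using assms(2)
proof (induction n arbitrary: F)
  case 0
  show ?case
  proof (cases "F = {}")
    case False
    then obtain D where "D \<in> F" by auto
    then show ?thesis by (intro disjI1 exI[of _ "\<lambda>_. D"]) auto
  qed auto
next
  case (Suc n)
  show ?case
  proof (cases "F = {}")
    case False
    have "\<exists>W B. B \<subseteq> W \<and> W \<subseteq> V \<and> card B \<le> q \<and> (\<exists>D\<in>F. D \<subseteq> W) \<and> (\<forall>D\<in>F. \<not> D \<subseteq> W - B) \<and>
       (\<forall>a\<in>W - B. \<forall>b. (a, b) \<in> E \<longrightarrow> b \<in> W)"
      using sep False Suc.prems unfolding separable_def by presburger
    then obtain W B where WB': "B \<subseteq> W \<and> W \<subseteq> V \<and> card B \<le> q \<and> (\<exists>D\<in>F. D \<subseteq> W)"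
      and no: "\<forall>D\<in>F. \<not> D \<subseteq> W - B" and closed: "\<forall>a\<in>W - B. \<forall>b. (a, b) \<in> E \<longrightarrow> b \<in> W"
      by (elim exE conjE) simp
    then obtain D where WB: "B \<subseteq> W" "W \<subseteq> V" "card B \<le> q" "D \<in> F" "D \<subseteq> W"
      by auto
    define F' where "F' = {D'\<in>F. D' \<inter> B = {}}"
    \<comment> \<open>A member that avoids \<open>B\<close> and meets \<open>W\<close> could not
      leave \<open>W - B\<close>, but no member lies inside \<open>W - B\<close>.\<close>
    have disj: "D' \<inter> W = {}" if D': "D' \<in> F'" for D'
    proof (rule ccontr)
      assume "D' \<inter> W \<noteq> {}"
      then obtain x where "x \<in> D'" "x \<in> W - B"
        using D' by (auto simp: F'_def)
      moreover have "conn E D'"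
        using that Suc.prems by (auto simp: F'_def)
      ultimately have "D' \<subseteq> W - B"
        using closed that by (intro conn_closed_subset[of E D' x]) (auto simp: F'_def)
      then show False
        using no that by (auto simp: F'_def)
    qed
    have "\<forall>D\<in>F'. D \<subseteq> V \<and> conn E D"
      using Suc.prems by (auto simp: F'_def)
    from Suc.IH[OF this] show ?thesis
    proof (elim disjE exE conjE)
      fix d assume d: "\<forall>i\<le>n. d i \<in> F'" "\<forall>i\<le>n. \<forall>j\<le>n. i \<noteq> j \<longrightarrow> d i \<inter> d j = {}"
      let ?d = "d(Suc n := D)"
      have "?d i \<in> F" if "i \<le> Suc n" for i
        using d(1) WB that by (auto simp: F'_def le_Suc_eq)
      moreover have "?d i \<inter> ?d j = {}" if "i \<le> Suc n" "j \<le> Suc n" "i \<noteq> j" for i j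
        using that d disj WB(5) by (auto simp: le_Suc_eq) blast+
      ultimately show ?thesis
        by (intro disjI1 exI[of _ ?d]) blast
    next
      fix X assume X: "X \<subseteq> V" "card X \<le> n * q" "\<forall>D\<in>F'. D \<inter> X \<noteq> {}"
      have "card (X \<union> B) \<le> Suc n * q"
        using card_Un_le[of X B] X(2) WB(3) by simp
      moreover have "\<forall>D\<in>F. D \<inter> (X \<union> B) \<noteq> {}"
        using X(3) by (auto simp: F'_def)
      moreover have "X \<union> B \<subseteq> V"
        using X WB by auto
      ultimately show ?thesis
        by (intro disjI2 exI[of _ "X \<union> B"]) blast
    qed
  qed auto
qed

section \<open>Splitting a component\<close>

definition clique_model :: "'a rel \<Rightarrow> 'a set \<Rightarrow> 'i set \<Rightarrow> ('i \<Rightarrow> 'a set) \<Rightarrow> bool" where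
  "clique_model E V L U \<longleftrightarrow> (\<forall>i\<in>L. U i \<subseteq> V \<and> conn E (U i)) \<and>
     (\<forall>i\<in>L. \<forall>j\<in>L. i \<noteq> j \<longrightarrow> U i \<inter> U j = {} \<and> touches E (U i) (U j))"

text \<open>The sets \<open>d k\<close> need not touch one another, as they model the independent
  side. The clique side has an arbitrary index set, because its indices will be numbers of
  parts.\<close>

definition K_star_model :: "'a rel \<Rightarrow> 'a set \<Rightarrow> 'i set \<Rightarrow> ('i \<Rightarrow> 'a set) \<Rightarrow> nat \<Rightarrow> (nat \<Rightarrow> 'a set) \<Rightarrow> bool" where
  "K_star_model E V L U t d \<longleftrightarrow> clique_model E V L U \<and>
     (\<forall>k<t. d k \<subseteq> V \<and> conn E (d k)) \<and> (\<forall>k<t. \<forall>l<t. k \<noteq> l \<longrightarrow> d k \<inter> d l = {}) \<and>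
     (\<forall>i\<in>L. \<forall>k<t. U i \<inter> d k = {} \<and> touches E (U i) (d k))"

definition full_sets :: "'a rel \<Rightarrow> 'i set \<Rightarrow> ('i \<Rightarrow> 'a set) \<Rightarrow> 'a set \<Rightarrow> 'a set set" where
  "full_sets E L U C = {D. D \<subseteq> C \<and> conn E D \<and> (\<forall>i\<in>L. touches E (U i) D)}"

text \<open>
  The flag \<open>ext\<close> tells whether one more set may be added to the clique model.
\<close>

definition splitter :: "'a rel \<Rightarrow> 'i set \<Rightarrow> ('i \<Rightarrow> 'a set) \<Rightarrow> 'a set \<Rightarrow> bool \<Rightarrow> 'a set \<Rightarrow> bool" where
  "splitter E L U C ext X \<longleftrightarrow> X \<subseteq> C \<and> (\<forall>C'. component E (C - X) C' \<longrightarrow>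
     C' \<notin> full_sets E L U C \<or>
     ext \<and> (\<exists>Y\<in>full_sets E L U C. Y \<inter> C' = {} \<and> (\<forall>c\<in>C'. \<forall>z\<in>C - C'. (c, z) \<in> E \<longrightarrow> z \<in> Y)))"

lemma touches_mono: "touches E A B \<Longrightarrow> A \<subseteq> A' \<Longrightarrow> B \<subseteq> B' \<Longrightarrow> touches E A' B'"
  by (auto simp: touches_def)

text \<open>Let \<open>Y\<close> be the component of \<open>C \<inter> W\<close> around a full set,
  and split with \<open>B \<inter> Y\<close>. A remaining component that meets \<open>Y\<close>
  stays in \<open>W - B\<close> and is not full. One that misses \<open>Y\<close> has all its
  neighbours in the rest of \<open>C\<close> within \<open>B \<inter> Y\<close>, hence in
  \<open>Y\<close>.\<close>

lemma splitter_extend: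
  assumes E: "sym E" and V: "finite V" and sep: "separable E V q"
    and C: "C \<subseteq> V" "C \<in> full_sets E L U C"
  shows "\<exists>X. splitter E L U C True X \<and> card X \<le> q"
proof -
  let ?F = "full_sets E L U C"
  have "?F \<noteq> {}" "\<forall>D\<in>?F. D \<subseteq> V \<and> conn E D"
    using C by (auto simp: full_sets_def)
  then have "\<exists>W B. B \<subseteq> W \<and> W \<subseteq> V \<and> card B \<le> q \<and> (\<exists>D\<in>?F. D \<subseteq> W) \<and> (\<forall>D\<in>?F. \<not> D \<subseteq> W - B) \<and>
       (\<forall>a\<in>W - B. \<forall>b. (a, b) \<in> E \<longrightarrow> b \<in> W)"
    using sep unfolding separable_def by presburger
  then obtain W B where WB': "B \<subseteq> W \<and> W \<subseteq> V \<and> card B \<le> q \<and> (\<exists>D\<in>?F. D \<subseteq> W)"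
    and no: "\<forall>D\<in>?F. \<not> D \<subseteq> W - B" and closed: "\<forall>a\<in>W - B. \<forall>b. (a, b) \<in> E \<longrightarrow> b \<in> W"
    by (elim exE conjE) simp
  then obtain D where WB: "B \<subseteq> W" "W \<subseteq> V" "card B \<le> q" "D \<in> ?F" "D \<subseteq> W"
    by auto
  have D: "conn E D" "D \<subseteq> C \<inter> W"
    using WB by (auto simp: full_sets_def)
  obtain x where x: "x \<in> D"
    using conn_nonempty[OF D(1)] by auto
  then obtain Y where Y: "component E (C \<inter> W) Y" "x \<in> Y"
    using component_exists[OF E, of x "C \<inter> W"] D by auto
  have DY: "D \<subseteq> Y"
    using component_absorb[OF Y(1) D] x Y by auto
  have YF: "Y \<in> ?F"
    using Y DY WB(4) touches_mono[of E _ D _ Y] by (auto simp: full_sets_def component_def)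
  have "splitter E L U C True (B \<inter> Y)"
    unfolding splitter_def
  proof (intro conjI allI impI)
    show "B \<inter> Y \<subseteq> C"
      using Y by (auto simp: component_def)
    fix C' assume C': "component E (C - B \<inter> Y) C'"
    then have C'p: "C' \<subseteq> C - B \<inter> Y" "conn E C'"
      by (auto simp: component_def)
    show "C' \<notin> ?F \<or> True \<and> (\<exists>Y\<in>?F. Y \<inter> C' = {} \<and> (\<forall>c\<in>C'. \<forall>z\<in>C - C'. (c, z) \<in> E \<longrightarrow> z \<in> Y))"
    proof (cases "Y \<inter> C' = {}")
      case True
      moreover have "z \<in> Y" if "c \<in> C'" "z \<in> C - C'" "(c, z) \<in> E" for c z
        using that C' by (auto simp: component_def)
      ultimately show ?thesis
        using YF by blast
    next
      case False
      then obtain y where y: "y \<in> C'" "y \<in> Y" by auto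
      have "C' \<subseteq> Y"
        using C'p(2) y
      proof (rule conn_closed_subset)
        fix a b assume "a \<in> Y" "a \<in> C'" "b \<in> C'" "(a, b) \<in> E"
        then show "b \<in> Y"
          using closed C'p Y(1) unfolding component_def by blast
      qed
      then have "C' \<subseteq> W - B"
        using C'p Y by (auto simp: component_def)
      then show ?thesis
        using no by auto
    qed
  qed
  moreover have "card (B \<inter> Y) \<le> q"
    using WB V by (meson card_mono finite_subset inf_le1 order_trans)
  ultimately show ?thesis
    by blast
qed

text \<open>By \<open>noK\<close> there are no \<open>t\<close> disjoint full sets, so
  \<open>packing_or_hitting\<close> with \<open>n = t - 1\<close> yields a small set that meets
  every full set. Off this set no component is full.\<close>

lemma splitter_hitting:
  assumes V: "finite V" and sep: "separable E V q"
    and t: "t > 0" and noK: "\<And>d. \<not> K_star_model E V L U t d"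
    and U: "clique_model E V L U" "\<And>i. i \<in> L \<Longrightarrow> U i \<inter> C = {}" and C: "C \<subseteq> V"
  shows "\<exists>X. splitter E L U C False X \<and> card X \<le> (t - 1) * q"
proof -
  let ?F = "full_sets E L U C"
  have F: "\<forall>D\<in>?F. D \<subseteq> V \<and> conn E D"
    using C by (auto simp: full_sets_def)
  have "\<nexists>d. (\<forall>i\<le>t - 1. d i \<in> ?F) \<and> (\<forall>i\<le>t - 1. \<forall>j\<le>t - 1. i \<noteq> j \<longrightarrow> d i \<inter> d j = {})"
  proof (rule notI, elim exE)
    fix d assume *: "(\<forall>i\<le>t - 1. d i \<in> ?F) \<and> (\<forall>i\<le>t - 1. \<forall>j\<le>t - 1. i \<noteq> j \<longrightarrow> d i \<inter> d j = {})"
    have le: "k \<le> t - 1" if "k < t" for k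
      using that by simp
    have "K_star_model E V L U t d"
      unfolding K_star_model_def
    proof (intro conjI allI impI ballI)
      fix k assume "k < t"
      then have dk: "d k \<in> ?F"
        using * le by blast
      then show "d k \<subseteq> V" "conn E (d k)"
        using F by auto
      show "d k \<inter> d l = {}" if "l < t" "k \<noteq> l" for l
        using * le[OF \<open>k < t\<close>] le[OF that(1)] that(2) by blast
      show "U i \<inter> d k = {}" "touches E (U i) (d k)" if "i \<in> L" for i
        using dk U(2)[OF that] that by (auto simp: full_sets_def)
    qed (fact U(1))
    then show False
      using noK by blast
  qed
  then have "\<exists>X\<subseteq>V. card X \<le> (t - 1) * q \<and> (\<forall>D\<in>?F. D \<inter> X \<noteq> {})"
    using packing_or_hitting[OF sep F, of "t - 1"] by argo
  then obtain X where X: "X \<subseteq> V" "card X \<le> (t - 1) * q" "\<forall>D\<in>?F. D \<inter> X \<noteq> {}"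
    by auto
  have "splitter E L U C False (X \<inter> C)"
    using X(3) by (auto simp: splitter_def component_def full_sets_def)
  moreover have "card (X \<inter> C) \<le> (t - 1) * q"
    using X V by (meson card_mono finite_subset inf_le1 order_trans)
  ultimately show ?thesis
    by blast
qed

text \<open>Without \<open>Z\<close> in the splitter, \<open>C'\<close> and \<open>Z\<close> merge
  into one component, which is not full because it does not touch \<open>U j\<close>. Every other
  component of \<open>C - (X - Z)\<close> was already a component of \<open>C - X\<close>.\<close>

lemma splitter_shrink:
  assumes E: "sym E" and X: "splitter E L U C ext X"
    and C': "component E (C - X) C'" and j: "j \<in> L" "\<not> touches E (U j) C'"
    and Z: "component E (C - C') Z" "\<not> touches E (U j) Z" "touches E C' Z"
  shows "splitter E L U C ext (X - Z)"
proof -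
  have big: "component E (C - (X - Z)) (C' \<union> Z)"
  proof -
    have "conn E (C' \<union> Z)"
      using C' Z by (intro conn_Un[OF E]) (auto simp: component_def)
    moreover have "z \<in> C' \<union> Z" if "y \<in> C' \<union> Z" "z \<in> C - (X - Z)" "(y, z) \<in> E" for y z
      using that C' Z(1) unfolding component_def by blast
    ultimately show ?thesis
      using C' Z(1) unfolding component_def by blast
  qed
  have nt: "\<not> touches E (U j) (C' \<union> Z)"
    using j Z by (auto simp: touches_def)
  show ?thesis
    unfolding splitter_def
  proof (intro conjI allI impI)
    show "X - Z \<subseteq> C"
      using X by (auto simp: splitter_def)
    fix D assume D: "component E (C - (X - Z)) D"
    show "D \<notin> full_sets E L U C \<or>
      ext \<and> (\<exists>Y\<in>full_sets E L U C. Y \<inter> D = {} \<and> (\<forall>c\<in>D. \<forall>z\<in>C - D. (c, z) \<in> E \<longrightarrow> z \<in> Y))"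
    proof (cases "D \<inter> (C' \<union> Z) = {}")
      case False
      then have "D = C' \<union> Z"
        using component_eq[OF D big] by simp
      then show ?thesis
        using nt j by (auto simp: full_sets_def)
    next
      case True
      then have "component E (C - X) D"
        using D unfolding component_def by blast
      then show ?thesis
        using X by (simp add: splitter_def)
    qed
  qed
qed

text \<open>The two alternatives for \<open>C'\<close> are the two ways to continue:
  \<open>X\<close> replaces part \<open>j\<close>, or it joins the old parts with \<open>Y\<close>
  as its set. The first comes from a splitter of least size: a component \<open>Z\<close> that holds
  a neighbour of \<open>C'\<close> in \<open>X\<close> without touching \<open>U j\<close> could be
  removed from \<open>X\<close>.\<close>

lemma splitting_set:
  assumes E: "sym E" and V: "finite V" and sep: "separable E V q"
    and t: "t \<ge> 2" and s: "card L \<le> s"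
    and noK: "card L = s \<Longrightarrow> (\<And>d. \<not> K_star_model E V L U t d)"
    and U: "clique_model E V L U" "\<And>i. i \<in> L \<Longrightarrow> U i \<inter> C = {} \<and> touches E (U i) C"
    and C: "C \<subseteq> V" "conn E C"
  obtains X where "X \<subseteq> C" "X \<noteq> {}" "card X \<le> (t - 1) * q"
    "\<forall>C'. component E (C - X) C' \<longrightarrow>
      (\<exists>j\<in>L. \<not> touches E (U j) C' \<and>
        (\<forall>c\<in>C'. \<forall>x\<in>X. (c, x) \<in> E \<longrightarrow> (\<exists>Z. component E (C - C') Z \<and> x \<in> Z \<and> touches E (U j) Z))) \<or>
      (card L < s \<and> (\<exists>Y\<in>full_sets E L U C. Y \<inter> C' = {} \<and> (\<forall>c\<in>C'. \<forall>x\<in>X. (c, x) \<in> E \<longrightarrow> x \<in> Y)))"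
proof -
  let ?F = "full_sets E L U C" and ?ext = "card L < s"
  define ok where "ok X \<longleftrightarrow> splitter E L U C ?ext X \<and> card X \<le> (t - 1) * q" for X
  have CF: "C \<in> ?F"
    using U C by (auto simp: full_sets_def)
  have "\<exists>X. ok X"
  proof (cases ?ext)
    case True
    obtain X where "splitter E L U C True X" "card X \<le> q"
      using splitter_extend[OF E V sep C(1) CF] by auto
    \<comment> \<open>Here \<open>t \<ge> 2\<close> makes a whole bag affordable as a part.\<close>
    moreover from this have "card X \<le> (t - 1) * q"
    proof -
      have "1 * q \<le> (t - 1) * q"
        using t by (intro mult_le_mono1) simp
      with \<open>card X \<le> q\<close> show ?thesis
        by linarith
    qed
    ultimately show ?thesis
      using True by (intro exI[of _ X]) (simp add: ok_def)
  next
    case False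
    then show ?thesis
      using splitter_hitting[OF V sep _ noK U(1) _ C(1)] U(2) s t by (auto simp: ok_def)
  qed
  then obtain X where X: "ok X" and min: "\<And>X'. ok X' \<Longrightarrow> card X \<le> card X'"
    using ex_has_least_nat[of ok _ card] by blast
  have XC: "X \<subseteq> C" and Xs: "splitter E L U C ?ext X"
    using X by (auto simp: ok_def splitter_def)
  have small: "card X \<le> (t - 1) * q"
    using X by (simp add: ok_def)
  \<comment> \<open>For \<open>X = {}\<close> the only component is \<open>C\<close>, which is full,
    and a set \<open>Y\<close> inside \<open>C\<close> and disjoint from it would be empty. That
    \<open>X\<close> is nonempty lets the greedy procedure terminate.\<close>
  have ne: "X \<noteq> {}"
  proof
    assume "X = {}"
    moreover have "component E C C"
      using C by (simp add: component_def)
    ultimately obtain Y where "Y \<in> ?F" "Y \<inter> C = {}"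
      using Xs CF by (auto simp: splitter_def)
    then show False
      using conn_nonempty[of E Y] by (auto simp: full_sets_def)
  qed
  have "(\<exists>j\<in>L. \<not> touches E (U j) C' \<and>
        (\<forall>c\<in>C'. \<forall>x\<in>X. (c, x) \<in> E \<longrightarrow> (\<exists>Z. component E (C - C') Z \<and> x \<in> Z \<and> touches E (U j) Z))) \<or>
      (card L < s \<and> (\<exists>Y\<in>?F. Y \<inter> C' = {} \<and> (\<forall>c\<in>C'. \<forall>x\<in>X. (c, x) \<in> E \<longrightarrow> x \<in> Y)))"
    if C': "component E (C - X) C'" for C'
  proof -
    from C' have C'C: "C' \<subseteq> C - X" "conn E C'"
      by (auto simp: component_def)
    from Xs C' consider "C' \<notin> ?F" | Y where ?ext "Y \<in> ?F" "Y \<inter> C' = {}"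
      "\<forall>c\<in>C'. \<forall>z\<in>C - C'. (c, z) \<in> E \<longrightarrow> z \<in> Y"
      unfolding splitter_def by blast
    then show ?thesis
    proof cases
      case 2
      then have "\<forall>c\<in>C'. \<forall>x\<in>X. (c, x) \<in> E \<longrightarrow> x \<in> Y"
        using XC C'C by blast
      then show ?thesis
        using 2 by blast
    next
      case 1
      then obtain j where j: "j \<in> L" "\<not> touches E (U j) C'"
        using C'C by (auto simp: full_sets_def)
      have "\<exists>Z. component E (C - C') Z \<and> x \<in> Z \<and> touches E (U j) Z"
        if cx: "c \<in> C'" "x \<in> X" "(c, x) \<in> E" for c x
      proof -
        obtain Z where Z: "component E (C - C') Z" "x \<in> Z"
          using component_exists[OF E, of x "C - C'"] cx XC C'C by auto
        have "touches E (U j) Z"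
        proof (rule ccontr)
          assume "\<not> touches E (U j) Z"
          moreover have "touches E C' Z"
            using cx Z by (auto simp: touches_def)
          ultimately have "splitter E L U C ?ext (X - Z)"
            using splitter_shrink[OF E Xs C' j Z(1)] by simp
          moreover have "card (X - Z) < card X"
            using cx Z XC C(1) V by (intro psubset_card_mono) (auto intro: finite_subset)
          ultimately show False
            using min[of "X - Z"] X by (simp add: ok_def)
        qed
        then show ?thesis
          using Z by blast
      qed
      then show ?thesis
        using j by blast
    qed
  qed
  then show ?thesis
    using that[OF XC ne small] by blast
qed

section \<open>The greedy partition\<close>

text \<open>One index names a part and its set in the clique model. \<open>U i\<close> may extend
  beyond \<open>P i\<close>; it has to cover the neighbours of \<open>C\<close> for which index
  \<open>i\<close> is responsible.\<close>

definition attached :: "'a rel \<Rightarrow> 'a set \<Rightarrow> (nat \<Rightarrow> 'a set) \<Rightarrow> 'a set \<Rightarrow> nat set \<Rightarrow> (nat \<Rightarrow> 'a set) \<Rightarrow> bool" where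
  "attached E V P C L U \<longleftrightarrow> clique_model E V L U \<and> (\<forall>i\<in>L. U i \<inter> C = {}) \<and>
     (\<forall>c\<in>C. \<forall>z. (c, z) \<in> E \<longrightarrow> z \<notin> C \<longrightarrow> (\<exists>i\<in>L. z \<in> P i \<inter> U i))"

text \<open>A tree decomposition built in the order of its nodes: node \<open>i\<close> introduces
  vertex \<open>i\<close>, and the earlier bag \<open>b\<close> that holds the other vertices of
  \<open>bag i\<close> becomes its parent.\<close>

definition tree_layout :: "nat \<Rightarrow> nat \<Rightarrow> (nat \<Rightarrow> nat set) \<Rightarrow> bool" where
  "tree_layout s n bag \<longleftrightarrow> n > 0 \<and> (\<forall>i<n. i \<in> bag i \<and> bag i \<subseteq> {..i} \<and> card (bag i) \<le> s + 1 \<and>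
     (i > 0 \<longrightarrow> (\<exists>b<i. bag i - {i} \<subseteq> bag b)))"

definition parts :: "'a rel \<Rightarrow> 'a set \<Rightarrow> nat \<Rightarrow> nat \<Rightarrow> (nat \<Rightarrow> 'a set) \<Rightarrow> (nat \<Rightarrow> nat set) \<Rightarrow> bool" where
  "parts E V m n P bag \<longleftrightarrow> (\<forall>i<n. P i \<subseteq> V \<and> card (P i) \<le> m) \<and>
     (\<forall>i<n. \<forall>j<n. i \<noteq> j \<longrightarrow> P i \<inter> P j = {}) \<and>
     (\<forall>i<n. \<forall>j<n. i < j \<longrightarrow> touches E (P i) (P j) \<longrightarrow> i \<in> bag j)"

definition rest :: "'a set \<Rightarrow> nat \<Rightarrow> (nat \<Rightarrow> 'a set) \<Rightarrow> 'a set" where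
  "rest V n P = V - (\<Union>i<n. P i)"

text \<open>The indices around \<open>C\<close> lie in a single earlier bag. This is what lets the
  next bag, made of such indices and the new one, be hung on the tree.\<close>

definition extendable :: "'a rel \<Rightarrow> 'a set \<Rightarrow> nat \<Rightarrow> nat \<Rightarrow> (nat \<Rightarrow> 'a set) \<Rightarrow> (nat \<Rightarrow> nat set) \<Rightarrow> bool" where
  "extendable E V s n P bag \<longleftrightarrow> (\<forall>C. component E (rest V n P) C \<longrightarrow>
     (\<exists>b<n. \<exists>L\<subseteq>bag b. \<exists>U. card L \<le> s \<and> attached E V P C L U))"

section \<open>Updating the sets attached to a component\<close>

lemma clique_model_subset: "clique_model E V L U \<Longrightarrow> L' \<subseteq> L \<Longrightarrow> clique_model E V L' U"
  unfolding clique_model_def by blast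

lemma clique_model_insert:
  assumes "sym E" "clique_model E V L U" "n \<notin> L" "A \<subseteq> V" "conn E A"
    and "\<And>i. i \<in> L \<Longrightarrow> U i \<inter> A = {} \<and> touches E (U i) A"
  shows "clique_model E V (insert n L) (U(n := A))"
  unfolding clique_model_def
proof (intro conjI ballI impI)
  fix i assume i: "i \<in> insert n L"
  show "(U(n := A)) i \<subseteq> V" "conn E ((U(n := A)) i)"
    using assms(2,4,5) i by (auto simp: clique_model_def)
  fix j assume j: "j \<in> insert n L" "i \<noteq> j"
  have old: "U i \<inter> U j = {} \<and> touches E (U i) (U j)" if "i \<in> L" "j \<in> L"
    using assms(2) j(2) that unfolding clique_model_def by blast
  show "(U(n := A)) i \<inter> (U(n := A)) j = {}"
    using i j old assms(6)[of i] assms(6)[of j] by auto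
  show "touches E ((U(n := A)) i) ((U(n := A)) j)"
    using i j old assms(6)[of i] assms(6)[of j] touches_sym[OF assms(1), of "U j" A] by auto
qed

lemma attached_cong:
  assumes "\<And>i. i \<in> L \<Longrightarrow> P i = P' i"
  shows "attached E V P C L U \<Longrightarrow> attached E V P' C L U"
  using assms unfolding attached_def by blast

text \<open>A neighbour of \<open>C\<close> covered by \<open>U i\<close> witnesses that
  \<open>U i\<close> touches \<open>C\<close>, so dropping the other indices loses nothing. After
  pruning, a connected \<open>C\<close> is itself full.\<close>

lemma attached_prune:
  assumes "sym E" "attached E V P C L U"
  shows "attached E V P C {i\<in>L. touches E (U i) C} U"
proof -
  have "\<exists>i\<in>{i\<in>L. touches E (U i) C}. z \<in> P i \<inter> U i" if z: "c \<in> C" "(c, z) \<in> E" "z \<notin> C" for c z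
  proof -
    obtain i where i: "i \<in> L" "z \<in> P i \<inter> U i"
      using assms(2) z unfolding attached_def by blast
    moreover have "(z, c) \<in> E"
      using assms(1) z(2) by (rule symD)
    ultimately show ?thesis
      using z(1) by (auto simp: touches_def)
  qed
  moreover have "clique_model E V {i\<in>L. touches E (U i) C} U"
    using assms(2) by (auto simp: attached_def intro: clique_model_subset)
  ultimately show ?thesis
    using assms(2) by (auto simp: attached_def)
qed

text \<open>The neighbours of \<open>C'\<close> inside \<open>C\<close> lie in \<open>X\<close>,
  hence in \<open>Y\<close>; those outside \<open>C\<close> are covered as before. Since
  \<open>Y\<close> is full, it extends the clique model.\<close>

lemma attached_extend:
  assumes E: "sym E" and C: "attached E V P C L U" "C \<subseteq> V" and nL: "n \<notin> L" and X: "X \<subseteq> C"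
    and C': "component E (C - X) C'"
    and Y: "Y \<in> full_sets E L U C" "Y \<inter> C' = {}" "\<forall>c\<in>C'. \<forall>x\<in>X. (c, x) \<in> E \<longrightarrow> x \<in> Y"
  shows "attached E V (P(n := X)) C' (insert n L) (U(n := Y))"
proof -
  have C'C: "C' \<subseteq> C"
    using C' by (auto simp: component_def)
  have Yp: "Y \<subseteq> C" "conn E Y" "\<forall>i\<in>L. touches E (U i) Y"
    using Y by (auto simp: full_sets_def)
  have "clique_model E V (insert n L) (U(n := Y))"
    using C Yp unfolding attached_def by (intro clique_model_insert[OF E _ nL]) blast+
  moreover have "\<exists>i\<in>insert n L. z \<in> (P(n := X)) i \<inter> (U(n := Y)) i"
    if z: "c \<in> C'" "(c, z) \<in> E" "z \<notin> C'" for c z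
  proof (cases "z \<in> C")
    case True
    then have "z \<in> X"
      using C' z by (auto simp: component_def)
    then show ?thesis
      using Y z by auto
  next
    case False
    then obtain i where "i \<in> L" "z \<in> P i \<inter> U i"
      using C z C'C unfolding attached_def by blast
    then show ?thesis
      using nL by (intro bexI[of _ i]) auto
  qed
  moreover have "(U(n := Y)) i \<inter> C' = {}" if "i \<in> insert n L" for i
    using that C(1) C'C Y(2) unfolding attached_def by (cases "i = n") fastforce+
  ultimately show ?thesis
    unfolding attached_def by blast
qed

text \<open>No neighbour of \<open>C'\<close> lies in \<open>U j\<close>, so index \<open>j\<close>
  is free. Enlarging \<open>U j\<close> by the components of \<open>C - C'\<close> that it touches
  covers the neighbours of \<open>C'\<close> in \<open>X\<close>; the growth stays inside
  \<open>C\<close>, away from the other sets \<open>U i\<close> and from \<open>C'\<close>.\<close>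

lemma attached_replace:
  assumes E: "sym E" and C: "attached E V P C L U" "C \<subseteq> V" and nL: "n \<notin> L" and X: "X \<subseteq> C"
    and C': "component E (C - X) C'"
    and j: "j \<in> L" "\<not> touches E (U j) C'"
    and Z: "\<forall>c\<in>C'. \<forall>x\<in>X. (c, x) \<in> E \<longrightarrow> (\<exists>Z. component E (C - C') Z \<and> x \<in> Z \<and> touches E (U j) Z)"
  shows "\<exists>A. attached E V (P(n := X)) C' (insert n (L - {j})) (U(n := A))"
proof -
  have C'C: "C' \<subseteq> C"
    using C' by (auto simp: component_def)
  have cm: "clique_model E V L U" and UC: "\<And>i. i \<in> L \<Longrightarrow> U i \<inter> C = {}"
    using C by (auto simp: attached_def)
  define \<Z> where "\<Z> = {Z. component E (C - C') Z \<and> touches E (U j) Z}"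
  define A where "A = U j \<union> \<Union>\<Z>"
  have ZC: "\<Union>\<Z> \<subseteq> C - C'"
    by (auto simp: \<Z>_def component_def)
  have "conn E A"
    unfolding A_def using cm j
    by (intro conn_Un_UNION[OF E]) (auto simp: \<Z>_def component_def clique_model_def)
  moreover have "U i \<inter> A = {} \<and> touches E (U i) A" if "i \<in> L - {j}" for i
  proof
    have "U i \<inter> U j = {}" "touches E (U i) (U j)"
      using cm j that unfolding clique_model_def by blast+
    then show "U i \<inter> A = {}" "touches E (U i) A"
      using ZC UC[of i] that touches_mono[of E "U i" "U j" "U i" A] by (auto simp: A_def)
  qed
  moreover have "A \<subseteq> V"
    using cm j ZC C(2) by (auto simp: A_def clique_model_def)
  ultimately have "clique_model E V (insert n (L - {j})) (U(n := A))"
    using nL clique_model_subset[OF cm] by (intro clique_model_insert[OF E]) auto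
  moreover have "\<exists>i\<in>insert n (L - {j}). z \<in> (P(n := X)) i \<inter> (U(n := A)) i"
    if z: "c \<in> C'" "(c, z) \<in> E" "z \<notin> C'" for c z
  proof (cases "z \<in> C")
    case True
    then have zX: "z \<in> X"
      using C' z by (auto simp: component_def)
    then obtain Z' where "component E (C - C') Z'" "z \<in> Z'" "touches E (U j) Z'"
      using Z z by blast
    then have "z \<in> A"
      by (auto simp: A_def \<Z>_def)
    then show ?thesis
      using zX by auto
  next
    case False
    then obtain i where i: "i \<in> L" "z \<in> P i \<inter> U i"
      using C z C'C unfolding attached_def by blast
    moreover have "i \<noteq> j"
      using i j z symD[OF E z(2)] by (auto simp: touches_def)
    ultimately show ?thesis
      using nL by (intro bexI[of _ i]) auto
  qed
  moreover have "(U(n := A)) i \<inter> C' = {}" if "i \<in> insert n (L - {j})" for i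
    using that UC[of i] UC[OF j(1)] C'C ZC by (auto simp: A_def)
  ultimately show ?thesis
    unfolding attached_def by blast
qed

lemma extend_step:
  assumes E: "sym E" and V: "finite V" and sep: "separable E V q" and t: "t \<ge> 2"
    and noK: "\<And>(L :: nat set) U d. card L = s \<Longrightarrow> \<not> K_star_model E V L U t d"
    and lay: "tree_layout s n bag" and par: "parts E V ((t - 1) * q) n P bag"
    and ext: "extendable E V s n P bag" and ne: "rest V n P \<noteq> {}"
  shows "\<exists>X B. X \<noteq> {} \<and> X \<subseteq> rest V n P \<and> tree_layout s (Suc n) (bag(n := B)) \<and>
    parts E V ((t - 1) * q) (Suc n) (P(n := X)) (bag(n := B)) \<and>
    extendable E V s (Suc n) (P(n := X)) (bag(n := B))"
proof -
  let ?R = "rest V n P"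
  obtain x where "x \<in> ?R" using ne by auto
  then obtain C where C: "component E ?R C"
    using component_exists[OF E] by blast
  then have CR: "C \<subseteq> ?R" "conn E C" and CV: "C \<subseteq> V"
    by (auto simp: component_def rest_def)
  obtain b L0 U where b: "b < n" "L0 \<subseteq> bag b" and L0: "card L0 \<le> s" "attached E V P C L0 U"
    using ext C unfolding extendable_def by blast
  define L where "L = {i\<in>L0. touches E (U i) C}"
  have bagn: "bag i \<subseteq> {..i}" if "i < n" for i
    using lay that by (auto simp: tree_layout_def)
  have Ln: "L \<subseteq> {..<n}" and Lb: "L \<subseteq> bag b"
    using bagn[OF b(1)] b by (auto simp: L_def)
  have L0fin: "finite L0"
    using bagn[OF b(1)] b(2) by (meson finite_atMost finite_subset)
  have Ls: "card L \<le> s"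
    using L0 L0fin card_mono[of L0 L] by (auto simp: L_def)
  have finL: "finite L"
    using L0fin by (simp add: L_def)
  have att: "attached E V P C L U"
    unfolding L_def by (rule attached_prune[OF E L0(2)])
  have nL: "n \<notin> L"
    using Ln by auto
  have cm: "clique_model E V L U" and UC: "\<And>i. i \<in> L \<Longrightarrow> U i \<inter> C = {} \<and> touches E (U i) C"
    using att by (auto simp: attached_def L_def)
  obtain X where X: "X \<subseteq> C" "X \<noteq> {}" "card X \<le> (t - 1) * q"
    and comps: "\<forall>C'. component E (C - X) C' \<longrightarrow>
      (\<exists>j\<in>L. \<not> touches E (U j) C' \<and>
        (\<forall>c\<in>C'. \<forall>x\<in>X. (c, x) \<in> E \<longrightarrow> (\<exists>Z. component E (C - C') Z \<and> x \<in> Z \<and> touches E (U j) Z))) \<or>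
      (card L < s \<and> (\<exists>Y\<in>full_sets E L U C. Y \<inter> C' = {} \<and> (\<forall>c\<in>C'. \<forall>x\<in>X. (c, x) \<in> E \<longrightarrow> x \<in> Y)))"
    by (rule splitting_set[OF E V sep t Ls noK cm UC CV CR(2)])
  \<comment> \<open>The indices \<open>L\<close> lie in bag \<open>b\<close>, the parent of the new
    bag. Together with \<open>n\<close> they are at most \<open>s + 1\<close>.\<close>
  define P' bag' where "P' = P(n := X)" and "bag' = bag(n := insert n L)"
  have R': "rest V (Suc n) P' = ?R - X"
    by (auto simp: rest_def P'_def lessThan_Suc)
  have "tree_layout s (Suc n) bag'"
  proof -
    have "card (insert n L) \<le> s + 1"
      using Ls finL nL by simp
    moreover have "bag' n - {n} \<subseteq> bag' b"
      using b Lb by (auto simp: bag'_def)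
    then have "\<exists>b<n. bag' n - {n} \<subseteq> bag' b"
      using b by blast
    moreover have "\<exists>b<i. bag' i - {i} \<subseteq> bag' b" if i: "i < n" "i > 0" for i
    proof -
      obtain b where "b < i" "bag i - {i} \<subseteq> bag b"
        using lay i by (auto simp: tree_layout_def)
      then show ?thesis
        using i by (intro exI[of _ b]) (auto simp: bag'_def)
    qed
    moreover have "i \<in> bag' i \<and> bag' i \<subseteq> {..i} \<and> (i \<noteq> n \<longrightarrow> card (bag' i) \<le> s + 1)" if "i < Suc n" for i
      using that lay Ln by (auto simp: bag'_def less_Suc_eq tree_layout_def)
    moreover have "bag' n = insert n L"
      by (simp add: bag'_def)
    ultimately show ?thesis
      unfolding tree_layout_def by (metis less_Suc_eq zero_less_Suc)
  qed
  moreover have "parts E V ((t - 1) * q) (Suc n) P' bag'"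
  proof -
    have disj: "P i \<inter> X = {}" if "i < n" for i
      using that X CR by (auto simp: rest_def)
    \<comment> \<open>A neighbour of \<open>X\<close> in an old part lies outside \<open>C\<close>,
      hence in a part with index in \<open>L\<close>. Disjointness of the parts identifies that
      index with \<open>i\<close>.\<close>
    moreover have "i \<in> L" if i: "i < n" "touches E (P i) X" for i
    proof -
      obtain u v where uv: "u \<in> P i" "v \<in> X" "(u, v) \<in> E"
        using i(2) by (auto simp: touches_def)
      then have "u \<notin> C"
        using CR that by (auto simp: rest_def)
      then obtain k where k: "k \<in> L" "u \<in> P k"
        using att uv X symD[OF E uv(3)] unfolding attached_def by blast
      then have "k = i"
        using par that uv Ln unfolding parts_def by blast
      then show ?thesis
        using k by simp
    qed
    moreover have "X \<subseteq> V"
      using X CV by auto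
    ultimately show ?thesis
      using par X(3) unfolding parts_def P'_def bag'_def
      by (auto simp: less_Suc_eq Int_commute[of X])
  qed
  moreover have "extendable E V s (Suc n) P' bag'"
    unfolding extendable_def
  proof (intro allI impI)
    fix D assume "component E (rest V (Suc n) P') D"
    then have D: "component E (?R - X) D"
      by (simp add: R')
    show "\<exists>b<Suc n. \<exists>L\<subseteq>bag' b. \<exists>U. card L \<le> s \<and> attached E V P' D L U"
    proof (cases "D \<inter> C = {}")
      case True
      \<comment> \<open>A component away from \<open>C\<close> has no neighbour in \<open>X\<close>,
        so the step leaves it and its attachment unchanged.\<close>
      have "component E ?R D"
        using D C True X(1) E unfolding component_def by (blast dest: symD)
      then obtain b' L' U' where b': "b' < n" "L' \<subseteq> bag b'" "card L' \<le> s" "attached E V P D L' U'"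
        using ext unfolding extendable_def by blast
      have "n \<notin> L'"
        using bagn[OF b'(1)] b' by auto
      then have "attached E V P' D L' U'"
        using b'(4) by (elim attached_cong[rotated]) (auto simp: P'_def)
      then show ?thesis
        using b' by (intro exI[of _ b'] conjI exI[of _ L'] exI[of _ U']) (auto simp: bag'_def)
    next
      case False
      have "D \<subseteq> C"
        using component_absorb[OF C _ _ False] D by (auto simp: component_def)
      then have DC: "component E (C - X) D"
        using D CR unfolding component_def by blast
      from comps[rule_format, OF DC] show ?thesis
      proof (elim disjE bexE conjE)
        fix j assume "j \<in> L" "\<not> touches E (U j) D"
          "\<forall>c\<in>D. \<forall>x\<in>X. (c, x) \<in> E \<longrightarrow> (\<exists>Z. component E (C - D) Z \<and> x \<in> Z \<and> touches E (U j) Z)"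
        from attached_replace[OF E att CV nL X(1) DC this]
        obtain A where "attached E V P' D (insert n (L - {j})) (U(n := A))"
          by (auto simp: P'_def)
        \<comment> \<open>As \<open>n\<close> takes the place of \<open>j\<close>, the bound
          survives even when \<open>L\<close> already has \<open>s\<close> elements.\<close>
        moreover have "card (insert n (L - {j})) \<le> s"
          using Ls finL nL \<open>j \<in> L\<close> card_gt_0_iff[of L] by auto
        ultimately show ?thesis
          by (intro exI[of _ n] conjI exI[of _ "insert n (L - {j})"] exI[of _ "U(n := A)"])
            (auto simp: bag'_def)
      next
        fix Y assume "card L < s" and Y: "Y \<in> full_sets E L U C" "Y \<inter> D = {}"
          "\<forall>c\<in>D. \<forall>x\<in>X. (c, x) \<in> E \<longrightarrow> x \<in> Y"
        then have "card (insert n L) \<le> s"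
          using finL nL by simp
        then show ?thesis
          using attached_extend[OF E att CV nL X(1) DC Y]
          by (intro exI[of _ n] conjI exI[of _ "insert n L"] exI[of _ "U(n := Y)"])
            (auto simp: bag'_def P'_def)
      qed
    qed
  qed
  ultimately show ?thesis
    using X CR unfolding P'_def bag'_def
    by (intro exI[of _ X] exI[of _ "insert n L"]) auto
qed

lemma layout_exists:
  assumes E: "sym E" "E \<subseteq> V \<times> V" and V: "finite V" and sep: "separable E V q" and t: "t \<ge> 2"
    and noK: "\<And>(L :: nat set) U d. card L = s \<Longrightarrow> \<not> K_star_model E V L U t d"
  shows "\<exists>n P bag. tree_layout s n bag \<and> parts E V ((t - 1) * q) n P bag \<and> rest V n P = {}"
proof -
  have main: "\<exists>n P bag. tree_layout s n bag \<and> parts E V ((t - 1) * q) n P bag \<and> rest V n P = {}"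
    if "tree_layout s n bag" "parts E V ((t - 1) * q) n P bag" "extendable E V s n P bag"
    for n P bag
    using that
  proof (induction "card (rest V n P)" arbitrary: n P bag rule: less_induct)
    case less
    show ?case
    proof (cases "rest V n P = {}")
      case True
      then show ?thesis
        using less.prems by blast
    next
      case False
      from extend_step[OF E(1) V sep t noK less.prems False]
      obtain X B where X: "X \<noteq> {}" "X \<subseteq> rest V n P" and
        new: "tree_layout s (Suc n) (bag(n := B))"
          "parts E V ((t - 1) * q) (Suc n) (P(n := X)) (bag(n := B))"
          "extendable E V s (Suc n) (P(n := X)) (bag(n := B))"
        by blast
      have "rest V (Suc n) (P(n := X)) = rest V n P - X"
        by (auto simp: rest_def lessThan_Suc)
      moreover have "finite (rest V n P)"
        using V by (simp add: rest_def)
      ultimately have "card (rest V (Suc n) (P(n := X))) < card (rest V n P)"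
        using X by (intro psubset_card_mono) auto
      from less.hyps[OF this new] show ?thesis .
    qed
  qed
  \<comment> \<open>The procedure starts from one empty part, because a layout must have a node.
    Components then have no neighbours outside, and \<open>L = {}\<close> suffices.\<close>
  have "extendable E V s 1 (\<lambda>_. {}) (\<lambda>_. {0})"
    unfolding extendable_def
  proof (intro allI impI exI conjI)
    fix C assume "component E (rest V 1 (\<lambda>_. {})) C"
    then show "attached E V (\<lambda>_. {}) C {} (\<lambda>_. {})"
      using E by (auto simp: attached_def clique_model_def component_def rest_def)
  qed auto
  then show ?thesis
    by (intro main[of 1 "\<lambda>_. {0}" "\<lambda>_. {}"]) (auto simp: tree_layout_def parts_def)
qed

section \<open>Models and minors\<close>

lemma digraph_iso_image:
  assumes "pair_graph G" "inj_on h (pverts G)"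
  shows "digraph_iso (with_proj G) (with_proj \<lparr>pverts = h ` pverts G, parcs = map_prod h h ` parcs G\<rparr>)"
proof -
  interpret pair_graph G by fact
  let ?f = "\<lparr>iso_verts = h, iso_arcs = map_prod h h, iso_head = snd, iso_tail = fst\<rparr>"
  have "inj_on (map_prod h h) (parcs G)"
    using map_prod_inj_on[OF assms(2) assms(2)] assms(1)
    by (auto simp: pair_graph_iff intro: inj_on_subset)
  then have "pre_digraph.digraph_isomorphism (with_proj G) ?f"
    using assms(2) wf_digraph_axioms by (simp add: pre_digraph.digraph_isomorphism_def)
  moreover have "with_proj \<lparr>pverts = h ` pverts G, parcs = map_prod h h ` parcs G\<rparr> = app_iso ?f (with_proj G)"
    by (simp add: app_iso_def with_proj_def)
  ultimately show ?thesis
    unfolding digraph_iso_def by blast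
qed

lemma pair_graph_image:
  assumes "pair_graph G" "inj_on h (pverts G)"
  shows "pair_graph \<lparr>pverts = h ` pverts G, parcs = map_prod h h ` parcs G\<rparr>"
proof -
  have G: "finite (pverts G)" "parcs G \<subseteq> pverts G \<times> pverts G" "sym (parcs G)" "irrefl (parcs G)"
    using assms(1) by (auto simp: pair_graph_iff)
  have "sym (map_prod h h ` parcs G)"
    using G(3) by (force simp: sym_def)
  moreover have "irrefl (map_prod h h ` parcs G)"
    using G(2,4) assms(2) by (fastforce simp: irrefl_def inj_on_def)
  ultimately show ?thesis
    using G by (auto simp: pair_graph_iff)
qed

lemma subgraph_pairI:
  assumes "pair_graph S" "pair_graph G" "pverts S \<subseteq> pverts G" "parcs S \<subseteq> parcs G"
  shows "subgraph (with_proj S) (with_proj G)"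
proof -
  interpret S: pair_graph S by fact
  interpret G: pair_graph G by fact
  show ?thesis
    using assms(3,4) S.wf_digraph_axioms G.wf_digraph_axioms by (simp add: subgraph_def compatible_def)
qed

text \<open>\<open>contracts_to\<close> appends contractions at the end; the induction below needs
  to put one in front.\<close>

lemma contracts_to_contract_edge:
  assumes "contracts_to (contract_edge S u v) M" "(u, v) \<in> parcs S"
  shows "contracts_to S M"
  using assms
proof (induction "contract_edge S u v" M rule: contracts_to.induct)
  case refl
  then show ?case
    by (rule contracts_to.step[OF contracts_to.refl])
next
  case (step G' a b)
  then show ?case
    by (intro contracts_to.step) auto
qed

text \<open>If \<open>f\<close> is injective, \<open>S\<close> is already a copy of
  \<open>X\<close>. Otherwise a connected fibre with two vertices contains an edge; contracting it
  keeps the hypotheses with the same \<open>f\<close>, as both ends have the same image.\<close>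

lemma contract_fibres:
  assumes "pair_graph S" "f ` pverts S = pverts X"
    and "\<And>x. x \<in> pverts X \<Longrightarrow> conn (parcs S) {v\<in>pverts S. f v = x}"
    and "parcs X = {(f u, f v) |u v. (u, v) \<in> parcs S \<and> f u \<noteq> f v}"
  shows "\<exists>M. contracts_to S M \<and> digraph_iso (with_proj X) (with_proj M)"
  using assms
proof (induction "card (pverts S)" arbitrary: S rule: less_induct)
  case less
  have S: "finite (pverts S)" "parcs S \<subseteq> pverts S \<times> pverts S" "sym (parcs S)" "irrefl (parcs S)"
    using less.prems(1) by (auto simp: pair_graph_iff)
  show ?case
  proof (cases "inj_on f (pverts S)")
    case True
    define h where "h = inv_into (pverts S) f"
    have hf: "h (f v) = v" if "v \<in> pverts S" for v
      using True that by (simp add: h_def)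
    have img: "h ` pverts X = pverts S"
      using hf by (force simp: less.prems(2)[symmetric] image_image)
    have "map_prod h h ` parcs X = parcs S"
    proof (intro equalityI subsetI)
      fix e assume "e \<in> map_prod h h ` parcs X"
      then show "e \<in> parcs S"
        using hf S(2) by (auto simp: less.prems(4))
    next
      fix e assume e: "e \<in> parcs S"
      obtain u v where uv: "e = (u, v)" by (cases e)
      have mem: "u \<in> pverts S" "v \<in> pverts S" "u \<noteq> v"
        using e uv S by (auto simp: irrefl_def)
      then have "f u \<noteq> f v"
        using True by (auto dest: inj_onD)
      then have "(f u, f v) \<in> parcs X"
        using e uv by (auto simp: less.prems(4))
      then show "e \<in> map_prod h h ` parcs X"
        using mem hf uv by (force intro!: image_eqI[of _ _ "(f u, f v)"])
    qed
    with img have eq: "\<lparr>pverts = h ` pverts X, parcs = map_prod h h ` parcs X\<rparr> = S"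
      by simp
    have "pair_graph X"
      unfolding pair_graph_iff
    proof (intro conjI)
      show "finite (pverts X)"
        using S(1) by (simp flip: less.prems(2))
      show "parcs X \<subseteq> pverts X \<times> pverts X"
        using S(2) by (auto simp: less.prems(4) simp flip: less.prems(2))
      show "sym (parcs X)"
      proof (rule symI)
        fix a b assume "(a, b) \<in> parcs X"
        then obtain u v where uv: "a = f u" "b = f v" "(u, v) \<in> parcs S" "f u \<noteq> f v"
          unfolding less.prems(4) by auto
        then have "(v, u) \<in> parcs S" "f v \<noteq> f u"
          using symD[OF S(3)] by auto
        then show "(b, a) \<in> parcs X"
          unfolding less.prems(4) uv by blast
      qed
      show "irrefl (parcs X)"
        by (auto simp: less.prems(4) irrefl_def)
    qed
    moreover have "inj_on h (pverts X)"
      using hf by (auto simp: less.prems(2)[symmetric] inj_on_def)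
    ultimately have "digraph_iso (with_proj X) (with_proj S)"
      using digraph_iso_image[of X h] eq by simp
    then show ?thesis
      using contracts_to.refl by blast
  next
    case False
    then obtain a b where ab: "a \<in> pverts S" "b \<in> pverts S" "f a = f b" "a \<noteq> b"
      by (auto simp: inj_on_def)
    let ?F = "{v\<in>pverts S. f v = f a}"
    have "conn (parcs S) ?F"
      using less.prems(2,3) ab by blast
    then have "(a, b) \<in> (parcs S \<inter> ?F \<times> ?F)\<^sup>*"
      using ab by (auto simp: conn_def)
    then obtain w where w: "(a, w) \<in> parcs S" "w \<in> pverts S" "f w = f a"
      using ab(4) by (auto elim: converse_rtranclE)
    have aw: "a \<noteq> w"
      using w S(4) by (auto simp: irrefl_def)
    define g where "g = id(w := a)"
    let ?S = "contract_edge S a w"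
    have fg: "f (g v) = f v" for v
      using w by (simp add: g_def)
    have gS: "g v \<in> pverts S - {w}" if "v \<in> pverts S" for v
      using that ab aw by (simp add: g_def)
    have arcs: "parcs ?S = map_prod g g ` parcs S - Id" and verts: "pverts ?S = pverts S - {w}"
      by (simp_all add: contract_edge_def g_def)
    have "card (pverts ?S) < card (pverts S)"
      using w S(1) by (intro psubset_card_mono) (auto simp: verts)
    moreover have "pair_graph ?S"
      using less.prems(1) w(1) by (rule pair_graph_contract_edge)
    moreover have "f ` pverts ?S = pverts X"
      unfolding less.prems(2)[symmetric] verts using fg gS by (auto simp: image_iff) (metis DiffE DiffI fg gS singletonD)
    moreover have "conn (parcs ?S) {v\<in>pverts ?S. f v = x}" (is "conn _ ?N") if x: "x \<in> pverts X" for x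
    proof -
      let ?M = "{v\<in>pverts S. f v = x}"
      have M: "conn (parcs S) ?M"
        by (rule less.prems(3)[OF x])
      have gM: "g v \<in> ?N" if "v \<in> ?M" for v
        using that gS fg by (auto simp: verts)
      \<comment> \<open>The merging map \<open>g\<close> sends walks in a fibre to walks in its
        contraction; an arc whose ends are merged disappears.\<close>
      have walk: "(g u, g v) \<in> (parcs ?S \<inter> ?N \<times> ?N)\<^sup>*" if "(u, v) \<in> (parcs S \<inter> ?M \<times> ?M)\<^sup>*" for u v
        using that
      proof (induction rule: rtrancl_induct)
        case (step y z)
        then have yz: "(y, z) \<in> parcs S" "y \<in> ?M" "z \<in> ?M"
          by auto
        show ?case
        proof (cases "g y = g z")
          case True
          then show ?thesis
            using step.IH by simp
        next
          case False
          then have "(g y, g z) \<in> parcs ?S"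
            using yz(1) by (force simp: arcs)
          then have "(g y, g z) \<in> parcs ?S \<inter> ?N \<times> ?N"
            using gM yz by blast
          then show ?thesis
            using step.IH by (rule rtrancl_into_rtrancl[rotated])
        qed
      qed simp
      have gid: "g v = v" "v \<in> ?M" if "v \<in> ?N" for v
        using that by (auto simp: g_def verts)
      have "?N \<noteq> {}"
        using gM conn_nonempty[OF M] by blast
      moreover have "(u, v) \<in> (parcs ?S \<inter> ?N \<times> ?N)\<^sup>*" if "u \<in> ?N" "v \<in> ?N" for u v
        using walk[of u v] gid[OF that(1)] gid[OF that(2)] M by (auto simp: conn_def)
      ultimately show ?thesis
        unfolding conn_def by blast
    qed
    moreover have "parcs X = {(f u, f v) |u v. (u, v) \<in> parcs ?S \<and> f u \<noteq> f v}"
    proof (intro equalityI subsetI)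
      fix e assume "e \<in> parcs X"
      then obtain u v where uv: "e = (f u, f v)" "(u, v) \<in> parcs S" "f u \<noteq> f v"
        unfolding less.prems(4) by blast
      then have "(g u, g v) \<in> parcs ?S" "f (g u) \<noteq> f (g v)" "e = (f (g u), f (g v))"
        using fg by (auto simp: arcs) metis
      then show "e \<in> {(f u, f v) |u v. (u, v) \<in> parcs ?S \<and> f u \<noteq> f v}"
        by blast
    next
      fix e assume "e \<in> {(f u, f v) |u v. (u, v) \<in> parcs ?S \<and> f u \<noteq> f v}"
      then obtain u v where "e = (f (g u), f (g v))" "(u, v) \<in> parcs S" "f (g u) \<noteq> f (g v)"
        unfolding arcs by auto
      then show "e \<in> parcs X"
        unfolding less.prems(4) fg by blast
    qed
    ultimately obtain M where M: "contracts_to ?S M" "digraph_iso (with_proj X) (with_proj M)"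
      using less.hyps by blast
    show ?thesis
      using contracts_to_contract_edge[OF M(1) w(1)] M(2) by blast
  qed
qed

lemma minor_of_model:
  assumes G: "pair_graph G" and X: "pair_graph X"
    and \<phi>: "\<And>x. x \<in> pverts X \<Longrightarrow> \<phi> x \<subseteq> pverts G \<and> conn (parcs G) (\<phi> x)"
    and disj: "\<And>x y. x \<in> pverts X \<Longrightarrow> y \<in> pverts X \<Longrightarrow> x \<noteq> y \<Longrightarrow> \<phi> x \<inter> \<phi> y = {}"
    and adj: "\<And>x y. (x, y) \<in> parcs X \<Longrightarrow> touches (parcs G) (\<phi> x) (\<phi> y)"
  shows "minor X G"
proof -
  define f where "f v = (THE x. x \<in> pverts X \<and> v \<in> \<phi> x)" for v
  have f: "f v = x" if "x \<in> pverts X" "v \<in> \<phi> x" for v x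
    unfolding f_def using that disj by (intro the_equality) auto
  define W where "W = (\<Union>x\<in>pverts X. \<phi> x)"
  \<comment> \<open>Edges between branch sets that are not adjacent in \<open>X\<close> are deleted
    first, because \<open>minor\<close> asks for an isomorphic copy of \<open>X\<close> after the
    contractions.\<close>
  define S where "S = \<lparr>pverts = W,
    parcs = {(u, v) \<in> parcs G. u \<in> W \<and> v \<in> W \<and> (f u = f v \<or> (f u, f v) \<in> parcs X)}\<rparr>"
  have Gp: "finite (pverts G)" "sym (parcs G)" "irrefl (parcs G)"
    and Xp: "parcs X \<subseteq> pverts X \<times> pverts X" "sym (parcs X)" "irrefl (parcs X)"
    using G X by (auto simp: pair_graph_iff)
  have WG: "W \<subseteq> pverts G"
    using \<phi> by (auto simp: W_def)
  have S: "pair_graph S"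
    unfolding pair_graph_iff
  proof (intro conjI)
    show "finite (pverts S)"
      using WG Gp(1) by (auto simp: S_def intro: finite_subset)
    show "parcs S \<subseteq> pverts S \<times> pverts S"
      by (auto simp: S_def)
    show "sym (parcs S)"
      using Gp(2) Xp(2) by (auto simp: S_def sym_def)
    show "irrefl (parcs S)"
      using Gp(3) by (auto simp: S_def irrefl_def)
  qed
  have fibre: "{v\<in>pverts S. f v = x} = \<phi> x" if "x \<in> pverts X" for x
    using that f by (auto simp: S_def W_def)
  have "\<exists>M. contracts_to S M \<and> digraph_iso (with_proj X) (with_proj M)"
  proof (rule contract_fibres[OF S])
    show "f ` pverts S = pverts X"
    proof (intro equalityI subsetI)
      fix x assume "x \<in> f ` pverts S"
      then show "x \<in> pverts X"
        using f by (auto simp: S_def W_def)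
    next
      fix x assume x: "x \<in> pverts X"
      then obtain v where "v \<in> \<phi> x"
        using \<phi> conn_nonempty by blast
      then show "x \<in> f ` pverts S"
        using x f by (auto simp: S_def W_def intro!: image_eqI[of _ _ v])
    qed
    show "conn (parcs S) {v\<in>pverts S. f v = x}" if x: "x \<in> pverts X" for x
    proof -
      have "parcs S \<inter> \<phi> x \<times> \<phi> x = parcs G \<inter> \<phi> x \<times> \<phi> x"
        using x f by (auto simp: S_def W_def)
      then show ?thesis
        using \<phi>[OF x] unfolding fibre[OF x] by (simp add: conn_def)
    qed
    show "parcs X = {(f u, f v) |u v. (u, v) \<in> parcs S \<and> f u \<noteq> f v}"
    proof (intro equalityI subsetI)
      fix e assume e: "e \<in> parcs X"
      obtain x y where xy: "e = (x, y)" by (cases e)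
      then have mem: "x \<in> pverts X" "y \<in> pverts X" "x \<noteq> y"
        using e Xp by (auto simp: irrefl_def)
      obtain u v where uv: "u \<in> \<phi> x" "v \<in> \<phi> y" "(u, v) \<in> parcs G"
        using adj[of x y] e xy by (auto simp: touches_def)
      have "f u = x" "f v = y"
        using f mem uv by auto
      moreover have "u \<in> W" "v \<in> W"
        using mem uv by (auto simp: W_def)
      ultimately show "e \<in> {(f u, f v) |u v. (u, v) \<in> parcs S \<and> f u \<noteq> f v}"
        using e xy uv(3) mem(3) by (auto simp: S_def)
    next
      fix e assume "e \<in> {(f u, f v) |u v. (u, v) \<in> parcs S \<and> f u \<noteq> f v}"
      then show "e \<in> parcs X"
        by (auto simp: S_def)
    qed
  qed
  moreover have "subgraph (with_proj S) (with_proj G)"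
    by (rule subgraph_pairI[OF S G]) (use WG in \<open>auto simp: S_def\<close>)
  ultimately show ?thesis
    using S unfolding minor_def by blast
qed

lemma minor_K_star:
  assumes G: "pair_graph G" and L: "card L = s" "finite L"
    and model: "K_star_model (parcs G) (pverts G) L U t d"
  shows "minor (K_star s t) G"
proof -
  obtain e where e: "bij_betw e {..<s} L"
    using L ex_bij_betw_nat_finite[of L] by (auto simp: atLeast0LessThan)
  have eL: "e i \<in> L" if "i < s" for i
    using e that by (auto simp: bij_betw_def)
  have inj: "e i \<noteq> e j" if "i < s" "j < s" "i \<noteq> j" for i j
    using e that by (auto simp: bij_betw_def inj_on_def)
  define \<phi> where "\<phi> = case_sum (\<lambda>i. U (e i)) d"
  have symG: "sym (parcs G)"
    using G by (simp add: pair_graph_iff)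
  have U: "U (e i) \<subseteq> pverts G" "conn (parcs G) (U (e i))" if "i < s" for i
    using model eL[OF that] by (auto simp: K_star_model_def clique_model_def)
  have UU: "U (e i) \<inter> U (e j) = {}" "touches (parcs G) (U (e i)) (U (e j))"
    if "i < s" "j < s" "i \<noteq> j" for i j
    using model eL[OF that(1)] eL[OF that(2)] inj[OF that]
    by (simp_all add: K_star_model_def clique_model_def)
  have Ud: "U (e i) \<inter> d k = {}" "touches (parcs G) (U (e i)) (d k)" "touches (parcs G) (d k) (U (e i))"
    if "i < s" "k < t" for i k
    using model eL[OF that(1)] that(2) touches_sym[OF symG] by (simp_all add: K_star_model_def)
  have d: "d k \<subseteq> pverts G" "conn (parcs G) (d k)" if "k < t" for k
    using model that by (auto simp: K_star_model_def)
  have dd: "d k \<inter> d l = {}" if "k < t" "l < t" "k \<noteq> l" for k l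
    using model that by (simp add: K_star_model_def)
  show ?thesis
  proof (rule minor_of_model[OF G pair_graph_K_star, of _ _ \<phi>])
    fix x assume "x \<in> pverts (K_star s t)"
    then have x: "(\<exists>i<s. x = Inl i) \<or> (\<exists>k<t. x = Inr k)"
      by (auto simp: K_star_def)
    then show "\<phi> x \<subseteq> pverts G \<and> conn (parcs G) (\<phi> x)"
      using U d by (elim disjE exE conjE) (simp_all add: \<phi>_def)
    fix y assume "y \<in> pverts (K_star s t)" "x \<noteq> y"
    then have "(\<exists>i<s. y = Inl i) \<or> (\<exists>k<t. y = Inr k)"
      by (auto simp: K_star_def)
    with x \<open>x \<noteq> y\<close> show "\<phi> x \<inter> \<phi> y = {}"
      using UU(1) Ud(1) dd by (elim disjE exE conjE) (simp_all add: \<phi>_def Int_commute)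
  next
    fix x y assume "(x, y) \<in> parcs (K_star s t)"
    then show "touches (parcs G) (\<phi> x) (\<phi> y)"
      using UU(2) Ud(2,3) by (auto simp: K_star_def \<phi>_def Let_def) blast
  qed
qed

section \<open>Treewidth of the quotient and the product\<close>

definition parent_tree :: "nat \<Rightarrow> (nat \<Rightarrow> nat) \<Rightarrow> nat pair_pre_digraph" where
  "parent_tree n par = \<lparr>pverts = {..<n},
     parcs = {(i, par i) |i. 0 < i \<and> i < n} \<union> {(par i, i) |i. 0 < i \<and> i < n}\<rparr>"

lemma sym_parent_tree: "sym (parcs (parent_tree n par))"
  by (auto simp: parent_tree_def sym_def)

lemma pair_graph_parent_tree:
  assumes "\<And>i. 0 < i \<Longrightarrow> i < n \<Longrightarrow> par i < i"
  shows "pair_graph (parent_tree n par)"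
proof -
  have "par i < n" "i \<noteq> par i" if "0 < i" "i < n" for i
    using assms[OF that] that by auto
  then show ?thesis
    using sym_parent_tree[of n par] unfolding pair_graph_iff
    by (auto simp: parent_tree_def irrefl_def)
qed

text \<open>Parents have smaller numbers, so from any node of \<open>S\<close> the chain of parents
  stays in \<open>S\<close> until it reaches \<open>c\<close>.\<close>

lemma conn_parent_tree:
  assumes par: "\<And>i. 0 < i \<Longrightarrow> i < n \<Longrightarrow> par i < i"
    and S: "S \<subseteq> {..<n}" "c \<in> S" "\<And>x. x \<in> S \<Longrightarrow> x \<noteq> c \<Longrightarrow> 0 < x \<and> par x \<in> S"
  shows "conn (parcs (parent_tree n par)) S"
proof (rule connI_center[OF sym_parent_tree S(2)])
  fix x assume "x \<in> S"
  then show "(c, x) \<in> (parcs (parent_tree n par) \<inter> S \<times> S)\<^sup>*"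
  proof (induction x rule: less_induct)
    case (less x)
    show ?case
    proof (cases "x = c")
      case False
      then have x: "0 < x" "par x \<in> S" "x < n"
        using S less.prems by auto
      then have "(c, par x) \<in> (parcs (parent_tree n par) \<inter> S \<times> S)\<^sup>*"
        using less.IH par by blast
      moreover have "(par x, x) \<in> parcs (parent_tree n par) \<inter> S \<times> S"
        using x less.prems by (auto simp: parent_tree_def)
      ultimately show ?thesis
        by (rule rtrancl_into_rtrancl)
    qed simp
  qed
qed

lemma pcas_nth:
  "pcas u p v \<Longrightarrow> Suc i < length p \<Longrightarrow> fst (p ! Suc i) = snd (p ! i)"
proof (induction p arbitrary: u i)
  case (Cons e p)
  then show ?case
    by (cases i; cases p) auto
qed simp

lemma pcas_ends:
  "pcas u p v \<Longrightarrow> p \<noteq> [] \<Longrightarrow> fst (p ! 0) = u \<and> snd (p ! (length p - 1)) = v"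
  by (induction p arbitrary: u) (auto simp: nth_Cons' neq_Nil_conv)

text \<open>On a cycle, both neighbours of the largest vertex would be its parent.\<close>

lemma undirected_tree_parent_tree:
  assumes par: "\<And>i. 0 < i \<Longrightarrow> i < n \<Longrightarrow> par i < i" and n: "n > 0"
  shows "undirected_tree (parent_tree n par)"
proof -
  let ?T = "parent_tree n par"
  have pg: "pair_graph ?T"
    using par by (rule pair_graph_parent_tree)
  then interpret T: pair_graph ?T .
  have "conn (parcs ?T) {..<n}"
    using par n less_trans by (intro conn_parent_tree[of n par _ 0]) blast+
  then have "Digraph_Component.connected (with_proj ?T)"
    using connected_iff_conn[OF pg] by (simp add: parent_tree_def)
  moreover have "\<not> (T.cycle p \<and> 3 \<le> length p)" for p
  proof
    assume "T.cycle p \<and> 3 \<le> length p"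
    then obtain u where p: "T.awalk u p u" "distinct (tl (pawalk_verts u p))" and len: "3 \<le> length p"
      unfolding T.cycle_def by auto
    have cas: "pcas u p u" and arcs: "set p \<subseteq> parcs ?T"
      using p by (auto simp: T.awalk_def)
    have ne: "p \<noteq> []"
      using len by auto
    have dist: "distinct (map snd p)"
      using p(2) T.awalk_verts_conv'[OF cas] ne by simp
    \<comment> \<open>Arc positions are read cyclically; the heads of arcs \<open>prev k\<close> and
      \<open>succ k\<close> are the two neighbours on the cycle of the head \<open>x\<close> of the
      preceding and current arcs respectively: the tail of arc \<open>k\<close>, and the vertex
      after \<open>x\<close>.\<close>
    define prev where "prev k = (if k = 0 then length p - 1 else k - 1)" for k
    define succ where "succ k = (if Suc k = length p then 0 else Suc k)" for k
    have prev: "prev k < length p" "fst (p ! k) = snd (p ! prev k)" if "k < length p" for k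
      using that pcas_nth[OF cas, of "k - 1"] pcas_ends[OF cas ne] by (auto simp: prev_def)
    have succ: "succ k < length p \<and> fst (p ! succ k) = snd (p ! k)" if "k < length p" for k
    proof (cases "Suc k = length p")
      case True
      then have "length p - 1 = k"
        by simp
      then show ?thesis
        using True ne pcas_ends[OF cas ne] by (simp add: succ_def)
    next
      case False
      then show ?thesis
        using that pcas_nth[OF cas, of k] by (simp add: succ_def)
    qed
    define x where "x = Max (snd ` set p)"
    have max: "snd (p ! k) \<le> x" if "k < length p" for k
      using that by (auto simp: x_def)
    have "x \<in> snd ` set p"
      unfolding x_def using ne by (intro Max_in) auto
    then obtain k where k: "k < length p" "snd (p ! k) = x"
      by (auto simp: in_set_conv_nth)
    have down: "a = par b" if "(a, b) \<in> parcs ?T \<or> (b, a) \<in> parcs ?T" "a \<le> b" for a b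
      using that par by (auto simp: parent_tree_def) (meson leD)+
    have arc: "(fst (p ! i), snd (p ! i)) \<in> parcs ?T" if "i < length p" for i
      using arcs that nth_mem by fastforce
    have "snd (p ! prev k) = par x"
      using arc[OF k(1)] max[OF prev(1)] prev(2) k by (intro down) auto
    moreover have "snd (p ! succ k) = par x"
      using arc[of "succ k"] max[of "succ k"] succ[OF k(1)] k by (intro down) auto
    \<comment> \<open>The heads of the arcs of a cycle are distinct, so equal neighbours force equal
      positions, which is impossible for length at least 3.\<close>
    ultimately have "prev k = succ k"
      using dist prev(1) succ k(1) by (metis distinct_conv_nth length_map nth_map)
    then show False
      using len k(1) by (auto simp: prev_def succ_def split: if_splits)
  qed
  ultimately show ?thesis
    using pg by (auto simp: undirected_tree_def)
qed

text \<open>With \<open>bag i \<subseteq> {..i}\<close>, this is the largest quotient graph that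
  \<open>parts\<close> permits.\<close>

definition layout_graph :: "nat \<Rightarrow> (nat \<Rightarrow> nat set) \<Rightarrow> nat pair_pre_digraph" where
  "layout_graph n bag = \<lparr>pverts = {..<n},
     parcs = {(i, j). i < n \<and> j < n \<and> i \<noteq> j \<and> (i \<in> bag j \<or> j \<in> bag i)}\<rparr>"

lemma pair_graph_layout_graph: "pair_graph (layout_graph n bag)"
  by (auto simp: pair_graph_iff layout_graph_def sym_def irrefl_def)

text \<open>The bags of the layout form a decomposition along the parent tree. Bag \<open>v\<close>
  is the first to contain \<open>v\<close>, and every later bag containing \<open>v\<close> passes
  it on to its parent.\<close>

lemma treewidth_layout_graph:
  assumes "tree_layout s n bag"
  shows "treewidth (layout_graph n bag) \<le> s"
proof -
  have n: "n > 0" and bag: "\<And>i. i < n \<Longrightarrow> i \<in> bag i \<and> bag i \<subseteq> {..i} \<and> card (bag i) \<le> s + 1"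
    and "\<forall>i. \<exists>b. 0 < i \<longrightarrow> i < n \<longrightarrow> b < i \<and> bag i - {i} \<subseteq> bag b"
    using assms by (auto simp: tree_layout_def)
  then obtain par where "\<forall>i. 0 < i \<longrightarrow> i < n \<longrightarrow> par i < i \<and> bag i - {i} \<subseteq> bag (par i)"
    by metis
  then have par: "\<And>i. 0 < i \<Longrightarrow> i < n \<Longrightarrow> par i < i"
    and nest: "\<And>i. 0 < i \<Longrightarrow> i < n \<Longrightarrow> bag i - {i} \<subseteq> bag (par i)"
    by auto
  let ?T = "parent_tree n par"
  have verts: "pverts ?T = {..<n}"
    by (simp add: parent_tree_def)
  have "tree_decomposition (layout_graph n bag) ?T bag"
    unfolding tree_decomposition_def
  proof (intro conjI ballI)
    show "undirected_tree ?T"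
      using par n by (rule undirected_tree_parent_tree)
    show "bag x \<subseteq> pverts (layout_graph n bag)" if "x \<in> pverts ?T" for x
      using bag[of x] that by (auto simp: verts layout_graph_def)
    show "case e of (u, v) \<Rightarrow> \<exists>x\<in>pverts ?T. u \<in> bag x \<and> v \<in> bag x"
      if "e \<in> parcs (layout_graph n bag)" for e
      using bag that by (auto simp: verts layout_graph_def)
    show "Digraph_Component.connected (with_proj ?T \<restriction> {x \<in> pverts ?T. v \<in> bag x})"
      if "v \<in> pverts (layout_graph n bag)" for v
      unfolding connected_induce_iff_conn[OF sym_parent_tree]
    proof (rule conn_parent_tree[OF par])
      show "v \<in> {x \<in> pverts ?T. v \<in> bag x}" "{x \<in> pverts ?T. v \<in> bag x} \<subseteq> {..<n}"
        using that bag by (auto simp: verts layout_graph_def)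
      fix x assume x: "x \<in> {x \<in> pverts ?T. v \<in> bag x}" "x \<noteq> v"
      then have "x < n" "v \<in> bag x" "v < x"
        using bag[of x] by (auto simp: verts)
      then show "0 < x \<and> par x \<in> {x \<in> pverts ?T. v \<in> bag x}"
        using nest[of x] par[of x] by (auto simp: verts)
    qed
  qed
  then have "treewidth (layout_graph n bag) \<le> decomposition_width ?T bag"
    unfolding treewidth_def by (intro Least_le) blast
  also have "Max ((\<lambda>x. card (bag x)) ` pverts ?T) \<le> s + 1"
    using bag n by (subst Max_le_iff) (auto simp: verts)
  then have "decomposition_width ?T bag \<le> s"
    by (simp add: decomposition_width_def)
  finally show ?thesis .
qed

text \<open>A vertex is sent to its part and its number inside that part. Edges within a part use
  the complete graph; edges between parts use the quotient, with any pair of numbers.\<close>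

lemma subgraph_of_layout_product:
  assumes G: "pair_graph G"
    and parts: "parts (parcs G) (pverts G) m n P bag" "rest (pverts G) n P = {}"
  shows "isomorphic_to_subgraph G (layout_graph n bag \<boxtimes> complete_graph m)"
proof -
  let ?Q = "layout_graph n bag \<boxtimes> complete_graph m"
  have finG: "finite (pverts G)" and arcsG: "parcs G \<subseteq> pverts G \<times> pverts G"
    and symG: "sym (parcs G)" and irr: "irrefl (parcs G)"
    using G by (auto simp: pair_graph_iff)
  have P: "P i \<subseteq> pverts G" "card (P i) \<le> m" if "i < n" for i
    using parts that by (auto simp: parts_def)
  have edge: "i \<in> bag j \<or> j \<in> bag i"
    if "i < n" "j < n" "i \<noteq> j" "touches (parcs G) (P i) (P j)" for i j
    using that parts(1) touches_sym[OF symG that(4)] unfolding parts_def by (meson nat_neq_iff)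
  have "\<forall>v. \<exists>i. v \<in> pverts G \<longrightarrow> i < n \<and> v \<in> P i"
    using parts(2) by (auto simp: rest_def)
  then obtain lab where lab: "\<And>v. v \<in> pverts G \<Longrightarrow> lab v < n \<and> v \<in> P (lab v)"
    by metis
  have "\<exists>g. inj_on g (P i) \<and> g ` P i \<subseteq> {..<m}" if "i < n" for i
    using P[OF that] finG finite_subset by (subst inj_on_iff_card_le) auto
  then obtain idx where idx: "\<And>i. i < n \<Longrightarrow> inj_on (idx i) (P i) \<and> idx i ` P i \<subseteq> {..<m}"
    by metis
  define h where "h v = (lab v, idx (lab v) v)" for v
  have hV: "idx (lab v) v < m" if "v \<in> pverts G" for v
    using lab[OF that] idx[of "lab v"] by blast
  have inj: "inj_on h (pverts G)"
  proof (rule inj_onI)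
    fix u v assume uv: "u \<in> pverts G" "v \<in> pverts G" "h u = h v"
    then have eq: "lab u = lab v" "idx (lab u) u = idx (lab v) v"
      unfolding h_def by blast+
    have "inj_on (idx (lab v)) (P (lab v))" "u \<in> P (lab v)" "v \<in> P (lab v)"
      using lab[OF uv(1)] lab[OF uv(2)] idx eq(1) by metis+
    then show "u = v"
      using eq by (metis inj_onD)
  qed
  let ?S = "\<lparr>pverts = h ` pverts G, parcs = map_prod h h ` parcs G\<rparr>"
  have "pverts ?S \<subseteq> pverts ?Q"
    using lab hV by (auto simp: h_def strong_product_def layout_graph_def complete_graph_def)
  moreover have "(h u, h v) \<in> parcs ?Q" if "(u, v) \<in> parcs G" for u v
  proof -
    have uv: "u \<in> pverts G" "v \<in> pverts G" "u \<noteq> v"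
      using that arcsG irr by (auto simp: irrefl_def)
    have "touches (parcs G) (P (lab u)) (P (lab v))"
      using lab[OF uv(1)] lab[OF uv(2)] that by (auto simp: touches_def)
    then have "lab u \<noteq> lab v \<Longrightarrow> lab u \<in> bag (lab v) \<or> lab v \<in> bag (lab u)"
      using edge lab uv by blast
    moreover have "h u \<noteq> h v"
      using inj uv by (auto dest: inj_onD)
    ultimately show ?thesis
      using lab[OF uv(1)] lab[OF uv(2)] hV[OF uv(1)] hV[OF uv(2)]
      by (cases "lab u = lab v") (auto simp: h_def strong_product_def layout_graph_def complete_graph_def)
  qed
  then have "parcs ?S \<subseteq> parcs ?Q"
    by auto
  ultimately have "subgraph (with_proj ?S) (with_proj ?Q)"
    using pair_graph_image[OF G inj]
      pair_graph_strong_product[OF pair_graph_layout_graph pair_graph_complete_graph]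
    by (intro subgraph_pairI)
  then show ?thesis
    unfolding isomorphic_to_subgraph_def
    using pair_graph_image[OF G inj] digraph_iso_image[OF G inj] by blast
qed

section \<open>Assembly from an optimal tree decomposition\<close>

theorem theorem5:
  fixes s t :: nat and G :: "'a pair_pre_digraph"
  assumes "s \<ge> 2" and "t \<ge> 2"
    and "pair_graph G"
    and "\<not> minor (K_star s t) G"
  shows "\<exists>H :: nat pair_pre_digraph. pair_graph H \<and> treewidth H \<le> s \<and>
           isomorphic_to_subgraph G (H \<boxtimes> complete_graph ((t - 1) * (treewidth G + 1)))"
proof -
  let ?E = "parcs G" and ?V = "pverts G"
  obtain T :: "nat pair_pre_digraph" and B where
    TB: "tree_decomposition G T B" "decomposition_width T B = treewidth G"
    using treewidth_attained[OF assms(3)] by blast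
  have "finite (pverts T)"
    using TB by (auto simp: tree_decomposition_def undirected_tree_def pair_graph_iff)
  then have "card (B x) \<le> Max ((\<lambda>x. card (B x)) ` pverts T)" if "x \<in> pverts T" for x
    using that by (intro Max_ge) auto
  \<comment> \<open>Truncated subtraction does no harm: a maximum is always at most its predecessor
    plus 1.\<close>
  then have "card (B x) \<le> treewidth G + 1" if "x \<in> pverts T" for x
    using that TB(2) unfolding decomposition_width_def by fastforce
  then have sep: "separable ?E ?V (treewidth G + 1)"
    by (rule separable_tree_decomposition[OF assms(3) TB(1)])
  have noK: "\<not> K_star_model ?E ?V L U t d" if "card L = s" for L :: "nat set" and U d
  proof
    assume "K_star_model ?E ?V L U t d"
    \<comment> \<open>An infinite set has cardinality 0, which \<open>s \<ge> 2\<close>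
      excludes.\<close>
    moreover have "finite L"
      using that assms(1) by (intro card_ge_0_finite) simp
    ultimately show False
      using minor_K_star[OF assms(3) that] assms(4) by blast
  qed
  have "sym ?E" "?E \<subseteq> ?V \<times> ?V" "finite ?V"
    using assms(3) by (auto simp: pair_graph_iff)
  from layout_exists[OF this sep assms(2), of s] noK
  obtain n P bag where "tree_layout s n bag" "parts ?E ?V ((t - 1) * (treewidth G + 1)) n P bag"
    "rest ?V n P = {}"
    by blast
  then show ?thesis
    using pair_graph_layout_graph treewidth_layout_graph subgraph_of_layout_product[OF assms(3)] by blast
qed

end
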